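(* Let $Q:C_+\to C_+$ satisfy (A1)–(A4), with associated limit maps $Q_\pm$ and $r^*\in \mathrm{Int}(Y_+)$. Assume that $Q_+$ satisfies (UC) with constants $c_-^*,c_+^*$, and that either $Q$ is subhomogeneous on $[0,r^*]_C$ and satisfies (SP), or $Q$ satisfies (ASH-UC-SP) (in which case $c_\pm^*=\lim_{l\to\infty}c_{\pm l}^*$). If $c_+^*>0$, then for any $\varepsilon\in\left(0,\min\{c_+^*,\frac{c_+^*+c_-^*}{2}\}\right)$ and any $\varphi\in C_+\setminus\{0\}$, $$\lim_{n\to\infty}\max\left\{\|Q^n[\varphi](\cdot,x)-r^*\|_Y:\ n\max\{\varepsilon,-c_-^*+\varepsilon\}\le x\le n(c_+^*-\varepsilon)\right\}=0.$$
   Context: Spaces. Fix $N\ge1$ and a compact topological space $M$. $X$ is the space of bounded continuous functions $\mathbb R\to\mathbb R^N$ with norm $\|\phi\|_X=\sum_{n\ge1}2^{-n}\sup_{|x|\le n}\|\phi(x)\|_{\mathbb R^N}$. $C=C(M,X)$ with norm $\sup_{\theta\in M}\|\varphi(\theta)\|_X$; elements of $C$ are identified with bounded continuous functions $\varphi(\theta,x)$ from $M\times\mathbb R$ to $\mathbb R^N$. $C_+=\{\varphi\in C:\varphi(\theta,x)\in\mathbb R_+^N\ \forall(\theta,x)\}$. $Y=C(M,\mathbb R^N)$ with sup norm, $Y_+=C(M,\mathbb R^N_+)$, $\mathrm{Int}(Y_+)=\{\beta\in Y:\beta(\theta)\in \mathrm{Int}(\mathbb R^N_+)\ \forall\theta\}$.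 Vectors of $\mathbb R^N$ and elements of $Y$ are identified with the elements of $C$ that are constant in the remaining variables. Order relations $\le$ are pointwise and componentwise. For $\psi\in C_+$, $C_\psi=[0,\psi]_C=\{\varphi\in C:0\le\varphi\le\psi\}$. $T_y[\varphi](\theta,x)=\varphi(\theta,x-y)$ for $y\in\mathbb R$. A max or sup over an empty set is taken to be $0$. Standing assumptions on a map $Q:C_+\to C_+$: (A1) $T_{-y}\circ Q[\varphi]\ge Q\circ T_{-y}[\varphi]$ for all $\varphi\in C_+$, $y\ge0$. (A2) For every vector $r\in\mathrm{Int}(\mathbb R_+^N)$, $Q|_{C_r}:C_r\to C_+$ is continuous, and monotone: $Q[\phi]\le Q[\psi]$ whenever $\phi\le\psi$ in $C_r$. By (A1), $T_{-y}\circ Q\circ T_y[\varphi](\theta,x)$ is nondecreasing in $y$; define $Q_\pm:C_+\to L^\infty(M\times\mathbb R,\mathbb R^N)$ by $Q_\pm[\varphi](\theta,x)=\lim_{y\to\pm\infty}T_{-y}\circ Q\circ T_y[\varphi](\theta,x)$. (A3) For all $\varphi\in C_+$, $n\in\mathbb N$: $T_{-y}\circ Q^n\circ T_y[\varphi]\to Q_\pm^n[\varphi]$ in $C$ as $y\to\pm\infty$. (A4) For every vector $r\in\mathrm{Int}(\mathbb R^N_+)$, $Q_\pm|_{C_r}:C_r\to C_+$ is continuous, $Q_+[0]=0$, and $Q_+[r^*]=r^*$ for some $r^*\in\mathrm{Int}(Y_+)$ (fixed). Properties: (SP) There is $N^*>0$ such that $Q^n[\varphi](\theta,x)\in\mathrm{Int}(\mathbb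 R^N_+)$ for all $n\ge N^*$, $(\theta,x)\in M\times(0,\infty)$, $\varphi\in C_+\setminus\{0\}$. (UC) There are $c_-^*,c_+^*\in\mathbb R$ with $c_+^*+c_-^*>0$ and $\lim_{n\to\infty}\max_{x\in n[-c_-^*+\varepsilon,\,c_+^*-\varepsilon]}\|Q_+^n[\varphi](\cdot,x)-r^*\|_Y=0$ for all $\varepsilon\in(0,\frac{c_+^*+c_-^*}{2})$ and $\varphi\in C_+\setminus\{0\}$. Subhomogeneity: $Q$ is subhomogeneous on $[0,r^*]_C$ if $Q[\kappa\phi]\ge\kappa Q[\phi]$ for all $\kappa\in[0,1]$, $\phi\in[0,r^*]_C$. (ASH-UC-SP) There are sequences $\{c_{\pm l}^*\}_{l\ge1}$ in $\mathbb R$, $\{r_l^*\}_{l\ge1}$ in $\mathrm{Int}(Y_+)$ and maps $Q_l:C_+\to C_+$ such that for every $l\geq 1$: (i) $Q_l$ satisfies (A1) and (A2), $Q_l[0]=0$, and $Q\ge Q_l$ on $C_{r^*}$; (ii) $T_{-y}\circ Q_l\circ T_y[\varphi]\to Q_l^+[\varphi]$ in $C$ as $y\to\infty$ for all $\varphi\in C_+$, where $Q_l^+[r_l^*]=r_l^*\le r^*$; (iii) $Q_l$ is subhomogeneous on $[0,r_l^*]_C$; (iv) $Q_l$ satisfies (SP), and $Q_l^+$ satisfies (UC) with $c_{-l}^*,c_{+l}^*,r_l^*$ in place of $c_-^*,c_+^*,r^*$. *)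

theory Defs
  imports "HOL-Analysis.Analysis"
begin

text \<open>
  The compact space \<open>M\<close> is the type \<open>'m\<close> (compactness is a hypothesis on \<open>UNIV :: 'm set\<close>), and
  an element of \<open>C\<close> is a curried function \<open>\<phi> \<theta> x\<close>. The order on \<open>real ^ 'n\<close> is componentwise and
  the order on functions is pointwise, so \<open>\<le>\<close> is the order of the paper on every space below.
\<close>

type_synonym ('m, 'n) state = "'m \<Rightarrow> real \<Rightarrow> real ^ 'n"

definition X_space :: "(real \<Rightarrow> real ^ 'n) set" where
  "X_space = {u. continuous_on UNIV u \<and> bounded (range u)}"

text \<open>The summation index of the paper is \<open>Suc n\<close>.\<close>

definition X_norm :: "(real \<Rightarrow> real ^ 'n) \<Rightarrow> real" where
  "X_norm u = (\<Sum>n. (1/2) ^ Suc n * (SUP x\<in>{- real (Suc n)..real (Suc n)}. norm (u x)))"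

definition C_space :: "('m::topological_space, 'n::finite) state set" where
  "C_space = {\<phi>. continuous_on UNIV (\<lambda>(\<theta>, x). \<phi> \<theta> x) \<and> bounded (range (\<lambda>(\<theta>, x). \<phi> \<theta> x))}"

definition C_norm :: "('m, 'n::finite) state \<Rightarrow> real" where
  "C_norm \<phi> = (SUP \<theta>. X_norm (\<phi> \<theta>))"

text \<open>
  The value outside \<open>C_space\<close> is immaterial; \<open>Metric_space\<close> asks for nonnegativity and symmetry
  on the whole type.
\<close>

definition C_dist :: "('m::topological_space, 'n::finite) state \<Rightarrow> ('m, 'n) state \<Rightarrow> real" where
  "C_dist \<phi> \<psi> = (if \<phi> \<in> C_space \<and> \<psi> \<in> C_space
    then C_norm (\<lambda>\<theta> x. \<phi> \<theta> x - \<psi> \<theta> x) else 0)"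

text \<open>
  The topology of \<open>C\<close> is that of \<open>C_norm\<close>, which is locally uniform in \<open>x\<close>; it is not the
  topology of uniform convergence on \<open>M \<times> \<real>\<close>.
\<close>

definition C_top :: "('m::topological_space, 'n::finite) state topology" where
  "C_top = Metric_space.mtopology C_space C_dist"

lemma X_norm_aux:
  fixes u :: "real \<Rightarrow> real ^ 'n"
  assumes B: "\<And>x. norm (u x) \<le> B"
  shows X_norm_summable:
      "summable (\<lambda>n. (1/2) ^ Suc n * (SUP x\<in>{- real (Suc n)..real (Suc n)}. norm (u x)))"
    and X_norm_le: "X_norm u \<le> B"
    and X_norm_ge: "\<bar>x\<bar> \<le> real (Suc k) \<Longrightarrow> (1/2) ^ Suc k * norm (u x) \<le> X_norm u"
    and X_norm_nonneg: "0 \<le> X_norm u"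
proof -
  define s where "s n = (SUP x\<in>{- real (Suc n)..real (Suc n)}. norm (u x))" for n
  have bdd: "bdd_above ((\<lambda>x. norm (u x)) ` S)" for S
    using B by (intro bdd_aboveI[of _ B]) auto
  have sB: "s n \<le> B" for n
    unfolding s_def by (rule cSUP_least) (use B in auto)
  have le_s: "norm (u x) \<le> s n" if "\<bar>x\<bar> \<le> real (Suc n)" for x n
    unfolding s_def by (rule cSUP_upper[OF _ bdd]) (use that in auto)
  have s0: "0 \<le> s n" for n
    using le_s[of 0 n] norm_ge_zero[of "u 0"] by linarith
  have geo: "(\<lambda>n. (1/2) ^ Suc n * B) sums (1 * B)"
    by (intro sums_mult2 power_half_series)
  have summ: "summable (\<lambda>n. (1/2) ^ Suc n * s n)"
    by (rule summable_comparison_test'[OF sums_summable[OF geo], of 0])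
      (use s0 sB in \<open>auto simp: abs_mult intro!: mult_left_mono\<close>)
  then show "summable (\<lambda>n. (1/2) ^ Suc n * (SUP x\<in>{- real (Suc n)..real (Suc n)}. norm (u x)))"
    by (simp add: s_def)
  have X: "X_norm u = (\<Sum>n. (1/2) ^ Suc n * s n)"
    by (simp add: X_norm_def s_def)
  have "X_norm u \<le> (\<Sum>n. (1/2) ^ Suc n * B)"
    unfolding X by (intro suminf_le summ sums_summable[OF geo] mult_left_mono sB) auto
  then show "X_norm u \<le> B"
    using sums_unique[OF geo] by simp
  show "0 \<le> X_norm u"
    unfolding X by (rule suminf_nonneg[OF summ]) (use s0 in auto)
  assume "\<bar>x\<bar> \<le> real (Suc k)"
  then have "(1/2) ^ Suc k * norm (u x) \<le> (1/2) ^ Suc k * s k"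
    by (intro mult_left_mono le_s) auto
  also have "\<dots> = (\<Sum>n\<in>{k}. (1/2) ^ Suc n * s n)"
    by simp
  also have "\<dots> \<le> X_norm u"
    unfolding X by (rule sum_le_suminf[OF summ]) (use s0 in auto)
  finally show "(1/2) ^ Suc k * norm (u x) \<le> X_norm u" .
qed

lemma X_norm_mono2:
  fixes u v w :: "real \<Rightarrow> real ^ 'n"
  assumes u: "\<And>x. norm (u x) \<le> A" and v: "\<And>x. norm (v x) \<le> B"
    and w: "\<And>x. norm (w x) \<le> norm (u x) + norm (v x)"
  shows "X_norm w \<le> X_norm u + X_norm v"
proof -
  have wB: "norm (w x) \<le> A + B" for x
    using u[of x] v[of x] w[of x] by linarith
  have bdd: "bdd_above ((\<lambda>x. norm (u x)) ` S)" "bdd_above ((\<lambda>x. norm (v x)) ` S)" for S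
    using u bdd_aboveI2[of S "\<lambda>x. norm (u x)" A] v bdd_aboveI2[of S "\<lambda>x. norm (v x)" B] by auto
  let ?I = "\<lambda>n. {- real (Suc n)..real (Suc n)}"
  have le: "(SUP x\<in>?I n. norm (w x)) \<le> (SUP x\<in>?I n. norm (u x)) + (SUP x\<in>?I n. norm (v x))" for n
  proof (rule cSUP_least)
    fix x assume x: "x \<in> ?I n"
    show "norm (w x) \<le> (SUP x\<in>?I n. norm (u x)) + (SUP x\<in>?I n. norm (v x))"
      using w[of x] cSUP_upper[OF x bdd(1)] cSUP_upper[OF x bdd(2)] by linarith
  qed auto
  have "X_norm w \<le> (\<Sum>n. (1/2) ^ Suc n * (SUP x\<in>?I n. norm (u x))
                        + (1/2) ^ Suc n * (SUP x\<in>?I n. norm (v x)))"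
    unfolding X_norm_def
  proof (intro suminf_le summable_add)
    fix n
    show "(1/2) ^ Suc n * (SUP x\<in>?I n. norm (w x))
        \<le> (1/2) ^ Suc n * (SUP x\<in>?I n. norm (u x)) + (1/2) ^ Suc n * (SUP x\<in>?I n. norm (v x))"
      unfolding distrib_left[symmetric] by (intro mult_left_mono le) auto
  qed (rule X_norm_summable, fact wB u v)+
  also have "\<dots> = X_norm u + X_norm v"
    unfolding X_norm_def
    by (rule suminf_add[symmetric]) (rule X_norm_summable, fact u v)+
  finally show ?thesis .
qed

lemma C_space_bound:
  assumes "\<phi> \<in> C_space" obtains B where "\<And>\<theta> x. norm (\<phi> \<theta> x) \<le> B"
  using assms by (force simp: C_space_def bounded_iff)

lemma C_space_diff_bound:
  assumes "\<phi> \<in> C_space" "\<psi> \<in> C_space"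
  obtains B where "\<And>\<theta> x. norm (\<phi> \<theta> x - \<psi> \<theta> x) \<le> B"
proof -
  obtain A B where "norm (\<phi> \<theta> x) \<le> A" "norm (\<psi> \<theta> x) \<le> B" for \<theta> x
    using C_space_bound assms by metis
  then have "norm (\<phi> \<theta> x - \<psi> \<theta> x) \<le> A + B" for \<theta> x
    by (meson add_mono norm_triangle_ineq4 order_trans)
  then show ?thesis by (rule that)
qed

lemma C_norm_ge:
  fixes \<phi> :: "('m, 'n::finite) state"
  assumes "\<And>\<theta> x. norm (\<phi> \<theta> x) \<le> B"
  shows "X_norm (\<phi> \<theta>) \<le> C_norm \<phi>"
  unfolding C_norm_def
  by (rule cSUP_upper) (use assms in \<open>auto intro!: bdd_aboveI2[of _ _ B] X_norm_le\<close>)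

lemma Metric_space_C: "Metric_space (C_space :: ('m::topological_space, 'n::finite) state set) C_dist"
proof (rule Metric_space.intro)
  fix \<phi> \<psi> :: "('m, 'n) state"
  show "C_dist \<phi> \<psi> = C_dist \<psi> \<phi>"
    by (auto simp: C_dist_def C_norm_def X_norm_def norm_minus_commute)
  show "0 \<le> C_dist \<phi> \<psi>"
  proof (cases "\<phi> \<in> C_space \<and> \<psi> \<in> C_space")
    case True
    then obtain B where B: "\<And>\<theta> x. norm (\<phi> \<theta> x - \<psi> \<theta> x) \<le> B"
      using C_space_diff_bound by blast
    show ?thesis
      using True C_norm_ge[of "\<lambda>\<theta> x. \<phi> \<theta> x - \<psi> \<theta> x", OF B, of undefined]
        X_norm_nonneg[of "\<lambda>x. \<phi> undefined x - \<psi> undefined x", OF B]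
      by (simp add: C_dist_def)
  qed (auto simp: C_dist_def)
next
  fix \<phi> \<psi> :: "('m, 'n) state"
  assume *: "\<phi> \<in> C_space" "\<psi> \<in> C_space"
  then obtain B where B: "\<And>\<theta> x. norm (\<phi> \<theta> x - \<psi> \<theta> x) \<le> B"
    using C_space_diff_bound by blast
  show "C_dist \<phi> \<psi> = 0 \<longleftrightarrow> \<phi> = \<psi>"
  proof
    assume "C_dist \<phi> \<psi> = 0"
    then have 0: "C_norm (\<lambda>\<theta> x. \<phi> \<theta> x - \<psi> \<theta> x) = 0"
      using * by (simp add: C_dist_def)
    show "\<phi> = \<psi>"
    proof (intro ext)
      fix \<theta> x
      obtain k where "\<bar>x\<bar> \<le> real k" using real_arch_simple by blast
      then have k: "\<bar>x\<bar> \<le> real (Suc k)" by simp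
      have "(1/2) ^ Suc k * norm (\<phi> \<theta> x - \<psi> \<theta> x) \<le> X_norm (\<lambda>x. \<phi> \<theta> x - \<psi> \<theta> x)"
        by (rule X_norm_ge[OF B k])
      also have "\<dots> \<le> 0"
        using C_norm_ge[of "\<lambda>\<theta> x. \<phi> \<theta> x - \<psi> \<theta> x", OF B, of \<theta>] 0 by simp
      finally have "norm (\<phi> \<theta> x - \<psi> \<theta> x) \<le> 0"
        using zero_less_power[of "1/2::real" "Suc k"] by (simp only: mult_le_0_iff) linarith
      then show "\<phi> \<theta> x = \<psi> \<theta> x" by simp
    qed
  qed (use * in \<open>simp add: C_dist_def C_norm_def X_norm_def\<close>)
next
  fix \<phi> \<psi> \<omega> :: "('m, 'n) state"
  assume *: "\<phi> \<in> C_space" "\<psi> \<in> C_space" "\<omega> \<in> C_space"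
  obtain A where A: "\<And>\<theta> x. norm (\<phi> \<theta> x - \<psi> \<theta> x) \<le> A"
    using C_space_diff_bound * by blast
  obtain B where B: "\<And>\<theta> x. norm (\<psi> \<theta> x - \<omega> \<theta> x) \<le> B"
    using C_space_diff_bound * by blast
  have "X_norm (\<lambda>x. \<phi> \<theta> x - \<omega> \<theta> x)
      \<le> C_norm (\<lambda>\<theta> x. \<phi> \<theta> x - \<psi> \<theta> x) + C_norm (\<lambda>\<theta> x. \<psi> \<theta> x - \<omega> \<theta> x)" for \<theta>
  proof -
    have "norm (\<phi> \<theta> x - \<omega> \<theta> x) \<le> norm (\<phi> \<theta> x - \<psi> \<theta> x) + norm (\<psi> \<theta> x - \<omega> \<theta> x)" for x
      using norm_triangle_ineq[of "\<phi> \<theta> x - \<psi> \<theta> x" "\<psi> \<theta> x - \<omega> \<theta> x"] by simp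
    then have "X_norm (\<lambda>x. \<phi> \<theta> x - \<omega> \<theta> x)
        \<le> X_norm (\<lambda>x. \<phi> \<theta> x - \<psi> \<theta> x) + X_norm (\<lambda>x. \<psi> \<theta> x - \<omega> \<theta> x)"
      by (rule X_norm_mono2[OF A B])
    then show ?thesis
      using C_norm_ge[of "\<lambda>\<theta> x. \<phi> \<theta> x - \<psi> \<theta> x", OF A, of \<theta>]
        C_norm_ge[of "\<lambda>\<theta> x. \<psi> \<theta> x - \<omega> \<theta> x", OF B, of \<theta>] by linarith
  qed
  then have "C_norm (\<lambda>\<theta> x. \<phi> \<theta> x - \<omega> \<theta> x)
      \<le> C_norm (\<lambda>\<theta> x. \<phi> \<theta> x - \<psi> \<theta> x) + C_norm (\<lambda>\<theta> x. \<psi> \<theta> x - \<omega> \<theta> x)"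
    unfolding C_norm_def[of "\<lambda>\<theta> x. \<phi> \<theta> x - \<omega> \<theta> x"] by (intro cSUP_least) auto
  then show "C_dist \<phi> \<omega> \<le> C_dist \<phi> \<psi> + C_dist \<psi> \<omega>"
    using * by (simp add: C_dist_def)
qed

text \<open>
  \<open>C_space\<close> consists of the jointly bounded continuous maps from \<open>M\<close> to \<open>X\<close>.
\<close>

lemma C_space_iff:
  fixes \<phi> :: "('m::topological_space, 'n::finite) state"
  shows "\<phi> \<in> C_space \<longleftrightarrow>
    (\<forall>\<theta>. \<phi> \<theta> \<in> X_space) \<and> (\<forall>\<theta>\<^sub>0. ((\<lambda>\<theta>. X_norm (\<lambda>x. \<phi> \<theta> x - \<phi> \<theta>\<^sub>0 x)) \<longlongrightarrow> 0) (nhds \<theta>\<^sub>0))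
    \<and> bounded (range (\<lambda>(\<theta>, x). \<phi> \<theta> x))"
proof (intro iffI conjI allI; (elim conjE)?)
  assume \<phi>: "\<phi> \<in> C_space"
  then have cont: "continuous_on UNIV (\<lambda>(\<theta>, x). \<phi> \<theta> x)" by (simp add: C_space_def)
  show "bounded (range (\<lambda>(\<theta>, x). \<phi> \<theta> x))" using \<phi> by (simp add: C_space_def)
  obtain B where B: "\<And>\<theta> x. norm (\<phi> \<theta> x) \<le> B" using C_space_bound[OF \<phi>] by blast
  show "\<phi> \<theta> \<in> X_space" for \<theta>
  proof -
    have "continuous_on UNIV (Pair \<theta> :: real \<Rightarrow> _)" by (intro continuous_intros)
    then show ?thesis
      using B continuous_on_compose2[OF cont, of UNIV "Pair \<theta>"]
      by (auto simp: X_space_def bounded_iff)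
  qed
  obtain D where D: "\<And>\<theta> \<theta>\<^sub>0 x. norm (\<phi> \<theta> x - \<phi> \<theta>\<^sub>0 x) \<le> D" and D0: "0 \<le> D"
  proof
    show "norm (\<phi> \<theta> x - \<phi> \<theta>\<^sub>0 x) \<le> B + B" for \<theta> \<theta>\<^sub>0 x
      by (meson B add_mono norm_triangle_ineq4 order_trans)
    show "0 \<le> B + B" using B[of undefined 0] norm_ge_zero[of "\<phi> undefined 0"] by linarith
  qed
  fix \<theta>\<^sub>0
  show "((\<lambda>\<theta>. X_norm (\<lambda>x. \<phi> \<theta> x - \<phi> \<theta>\<^sub>0 x)) \<longlongrightarrow> 0) (nhds \<theta>\<^sub>0)"
  proof (rule tendstoI)
    fix e :: real assume e: "0 < e"
    have "(\<lambda>k. (1/2) ^ k * D) \<longlonglongrightarrow> 0 * D"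
      by (intro tendsto_intros LIMSEQ_realpow_zero) auto
    then obtain k where k: "(1/2) ^ k * D < e / 2"
      using e order_tendstoD(2)[of _ "0 * D" sequentially "e/2"]
      by (auto simp: eventually_sequentially)
    have cont': "continuous_on (UNIV \<times> {- real k..real k}) (\<lambda>(\<theta>, x). \<phi> \<theta> x)"
      by (rule continuous_on_subset[OF cont]) simp
    have e4: "0 < e / 4" using e by simp
    obtain U where U: "\<theta>\<^sub>0 \<in> U" "open U"
      and U'': "\<forall>\<theta>\<in>U \<inter> UNIV. \<forall>x\<in>{- real k..real k}.
        dist (case (\<theta>, x) of (\<theta>, x) \<Rightarrow> \<phi> \<theta> x) (case (\<theta>\<^sub>0, x) of (\<theta>, x) \<Rightarrow> \<phi> \<theta> x) \<le> e / 4"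
      by (rule continuous_on_prod_compactE[OF cont' compact_Icc UNIV_I e4])
    have U': "dist (\<phi> \<theta> x) (\<phi> \<theta>\<^sub>0 x) \<le> e / 4" if "\<theta> \<in> U" "x \<in> {- real k..real k}" for \<theta> x
      using U'' that by simp
    have "X_norm (\<lambda>x. \<phi> \<theta> x - \<phi> \<theta>\<^sub>0 x) < e" if "\<theta> \<in> U" for \<theta>
    proof -
      let ?s = "\<lambda>n. SUP x\<in>{- real (Suc n)..real (Suc n)}. norm (\<phi> \<theta> x - \<phi> \<theta>\<^sub>0 x)"
      have geo: "(\<lambda>n. (1/2) ^ Suc n * (e/4)) sums (1 * (e/4))"
        by (intro sums_mult2 power_half_series)
      have geo2: "(\<lambda>n. if n < k then 0 else (1/2) ^ Suc n * D) sums ((1/2) ^ k * D)"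
      proof -
        have "(\<lambda>n. (1/2) ^ k * ((1/2) ^ Suc n * D)) sums ((1/2) ^ k * (1 * D))"
          by (intro sums_mult sums_mult2 power_half_series)
        then have "(\<lambda>n. if n + k < k then 0 else (1/2) ^ Suc (n + k) * D) sums ((1/2) ^ k * D)"
          by (simp add: power_add mult_ac)
        then show ?thesis
          by (subst (asm) sums_iff_shift) simp
      qed
      have s_le: "?s n \<le> D" for n
        by (rule cSUP_least) (use D in auto)
      have s_le': "?s n \<le> e / 4" if "n < k" for n
      proof (rule cSUP_least)
        fix x assume "x \<in> {- real (Suc n)..real (Suc n)}"
        with that have "x \<in> {- real k..real k}" by auto
        from U'[OF \<open>\<theta> \<in> U\<close> this] show "norm (\<phi> \<theta> x - \<phi> \<theta>\<^sub>0 x) \<le> e / 4" by (simp add: dist_norm)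
      qed auto
      have "X_norm (\<lambda>x. \<phi> \<theta> x - \<phi> \<theta>\<^sub>0 x)
          \<le> (\<Sum>n. (1/2) ^ Suc n * (e/4) + (if n < k then 0 else (1/2) ^ Suc n * D))"
        unfolding X_norm_def
      proof (intro suminf_le summable_add)
        fix n
        show "(1/2) ^ Suc n * ?s n \<le> (1/2) ^ Suc n * (e/4) + (if n < k then 0 else (1/2) ^ Suc n * D)"
        proof (cases "n < k")
          case True
          then show ?thesis using mult_left_mono[OF s_le'[OF True], of "(1/2) ^ Suc n"] by simp
        next
          case False
          have "(0::real) \<le> (1/2) ^ Suc n * (e/4)" using e by simp
          moreover have "(1/2) ^ Suc n * ?s n \<le> (1/2) ^ Suc n * D"
            by (rule mult_left_mono[OF s_le]) simp
          ultimately show ?thesis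
            unfolding if_not_P[OF False] by linarith
        qed
      qed (use X_norm_summable[OF D] sums_summable[OF geo] sums_summable[OF geo2] in auto)
      also have "\<dots> = e / 4 + (1/2) ^ k * D"
        using sums_unique[OF sums_add[OF geo geo2]] by simp
      finally show ?thesis using k e by linarith
    qed
    then show "\<forall>\<^sub>F \<theta> in nhds \<theta>\<^sub>0. dist (X_norm (\<lambda>x. \<phi> \<theta> x - \<phi> \<theta>\<^sub>0 x)) 0 < e"
      using U X_norm_nonneg[OF D] by (auto simp: eventually_nhds intro!: exI[of _ U])
  qed
next
  assume X: "\<forall>\<theta>. \<phi> \<theta> \<in> X_space"
    and lim: "\<forall>\<theta>\<^sub>0. ((\<lambda>\<theta>. X_norm (\<lambda>x. \<phi> \<theta> x - \<phi> \<theta>\<^sub>0 x)) \<longlongrightarrow> 0) (nhds \<theta>\<^sub>0)"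
    and bdd: "bounded (range (\<lambda>(\<theta>, x). \<phi> \<theta> x))"
  obtain B where B: "\<And>\<theta> x. norm (\<phi> \<theta> x) \<le> B"
    using bdd by (force simp: bounded_iff)
  have D: "norm (\<phi> \<theta> x - \<phi> \<theta>\<^sub>0 x) \<le> B + B" for \<theta> \<theta>\<^sub>0 x
    by (meson B add_mono norm_triangle_ineq4 order_trans)
  have "((\<lambda>(\<theta>, x). \<phi> \<theta> x) \<longlongrightarrow> \<phi> \<theta>\<^sub>0 x\<^sub>0) (nhds (\<theta>\<^sub>0, x\<^sub>0))" for \<theta>\<^sub>0 x\<^sub>0
  proof (rule tendstoI)
    fix e :: real assume e: "0 < e"
    obtain k where "\<bar>x\<^sub>0\<bar> + 1 \<le> real k" using real_arch_simple by blast
    then have k: "\<bar>x\<bar> \<le> real (Suc k)" if "dist x x\<^sub>0 < 1" for x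
      using that by (auto simp: dist_real_def)
    have "\<forall>\<^sub>F \<theta> in nhds \<theta>\<^sub>0. X_norm (\<lambda>x. \<phi> \<theta> x - \<phi> \<theta>\<^sub>0 x) < (1/2) ^ Suc k * (e/2)"
      using lim e by (intro order_tendstoD(2)[of _ 0]) auto
    moreover have "\<forall>\<^sub>F x in nhds x\<^sub>0. dist (\<phi> \<theta>\<^sub>0 x) (\<phi> \<theta>\<^sub>0 x\<^sub>0) < e/2"
      using X e by (intro tendstoD) (auto simp: X_space_def continuous_on_eq_continuous_at isCont_def tendsto_at_iff_tendsto_nhds)
    moreover have "\<forall>\<^sub>F x in nhds x\<^sub>0. dist x x\<^sub>0 < 1"
      by (intro tendstoD filterlim_ident) auto
    ultimately have "\<forall>\<^sub>F p in nhds \<theta>\<^sub>0 \<times>\<^sub>F nhds x\<^sub>0.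
        X_norm (\<lambda>x. \<phi> (fst p) x - \<phi> \<theta>\<^sub>0 x) < (1/2) ^ Suc k * (e/2)
        \<and> (dist (\<phi> \<theta>\<^sub>0 (snd p)) (\<phi> \<theta>\<^sub>0 x\<^sub>0) < e/2 \<and> dist (snd p) x\<^sub>0 < 1)"
      by (intro eventually_prodI eventually_conj) auto
    then show "\<forall>\<^sub>F p in nhds (\<theta>\<^sub>0, x\<^sub>0). dist (case p of (\<theta>, x) \<Rightarrow> \<phi> \<theta> x) (\<phi> \<theta>\<^sub>0 x\<^sub>0) < e"
      unfolding nhds_prod
    proof (rule eventually_mono, elim conjE)
      fix p
      assume 1: "X_norm (\<lambda>x. \<phi> (fst p) x - \<phi> \<theta>\<^sub>0 x) < (1/2) ^ Suc k * (e/2)"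
        and 2: "dist (\<phi> \<theta>\<^sub>0 (snd p)) (\<phi> \<theta>\<^sub>0 x\<^sub>0) < e/2" and 3: "dist (snd p) x\<^sub>0 < 1"
      have "(1/2) ^ Suc k * norm (\<phi> (fst p) (snd p) - \<phi> \<theta>\<^sub>0 (snd p)) < (1/2) ^ Suc k * (e/2)"
        by (rule le_less_trans[OF X_norm_ge[OF D k[OF 3]] 1])
      then have "dist (\<phi> (fst p) (snd p)) (\<phi> \<theta>\<^sub>0 (snd p)) < e/2"
        by (simp add: dist_norm)
      then have "dist (\<phi> (fst p) (snd p)) (\<phi> \<theta>\<^sub>0 x\<^sub>0) < e"
        using 2 dist_triangle[of "\<phi> (fst p) (snd p)" "\<phi> \<theta>\<^sub>0 x\<^sub>0" "\<phi> \<theta>\<^sub>0 (snd p)"] by linarith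
      then show "dist (case p of (\<theta>, x) \<Rightarrow> \<phi> \<theta> x) (\<phi> \<theta>\<^sub>0 x\<^sub>0) < e"
        by (simp add: case_prod_unfold)
    qed
  qed
  then have "continuous_on UNIV (\<lambda>(\<theta>, x). \<phi> \<theta> x)"
    unfolding continuous_on_def by (force intro: tendsto_mono[OF at_within_le_nhds])
  then show "\<phi> \<in> C_space"
    using bdd by (simp add: C_space_def)
qed

definition C_plus :: "('m::topological_space, 'n::finite) state set" where
  "C_plus = {\<phi> \<in> C_space. \<forall>\<theta> x. 0 \<le> \<phi> \<theta> x}"

definition C_zero :: "('m, 'n::finite) state" where
  "C_zero = (\<lambda>\<theta> x. 0)"

text \<open>The embeddings of \<open>\<real>\<^sup>N\<close> and of \<open>Y\<close> into \<open>C\<close>.\<close>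

definition vec_state :: "real ^ 'n \<Rightarrow> ('m, 'n::finite) state" where
  "vec_state r = (\<lambda>\<theta> x. r)"

definition Y_state :: "('m \<Rightarrow> real ^ 'n) \<Rightarrow> ('m, 'n::finite) state" where
  "Y_state \<beta> = (\<lambda>\<theta> x. \<beta> \<theta>)"

definition Int_pos :: "(real ^ 'n) set" where
  "Int_pos = interior {v. 0 \<le> v}"

definition Y_space :: "('m::topological_space \<Rightarrow> real ^ 'n) set" where
  "Y_space = {\<beta>. continuous_on UNIV \<beta>}"

definition Y_norm :: "('m \<Rightarrow> real ^ 'n) \<Rightarrow> real" where
  "Y_norm \<beta> = (SUP \<theta>. norm (\<beta> \<theta>))"

definition Int_Y_plus :: "('m::topological_space \<Rightarrow> real ^ 'n) set" where
  "Int_Y_plus = {\<beta> \<in> Y_space. \<forall>\<theta>. \<beta> \<theta> \<in> Int_pos}"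

definition C_below :: "('m::topological_space, 'n::finite) state \<Rightarrow> ('m, 'n) state set" where
  "C_below \<psi> = {\<phi> \<in> C_space. C_zero \<le> \<phi> \<and> \<phi> \<le> \<psi>}"

definition shift :: "real \<Rightarrow> ('m, 'n::finite) state \<Rightarrow> ('m, 'n) state" where
  "shift y \<phi> = (\<lambda>\<theta> x. \<phi> \<theta> (x - y))"

definition shift_conj ::
  "(('m, 'n::finite) state \<Rightarrow> ('m, 'n) state) \<Rightarrow> real \<Rightarrow> ('m, 'n) state \<Rightarrow> ('m, 'n) state" where
  "shift_conj P y \<phi> = shift (- y) (P (shift y \<phi>))"

text \<open>
  The limit maps \<open>Q\<^sub>\<plusminus>\<close>, taken pointwise; the limits exist on \<open>C_plus\<close> under \<open>(A1)\<close> and \<open>(A2)\<close>.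
\<close>

definition lim_plus ::
  "(('m, 'n::finite) state \<Rightarrow> ('m, 'n) state) \<Rightarrow> ('m, 'n) state \<Rightarrow> ('m, 'n) state" where
  "lim_plus Q \<phi> = (\<lambda>\<theta> x. Lim at_top (\<lambda>y. shift_conj Q y \<phi> \<theta> x))"

definition lim_minus ::
  "(('m, 'n::finite) state \<Rightarrow> ('m, 'n) state) \<Rightarrow> ('m, 'n) state \<Rightarrow> ('m, 'n) state" where
  "lim_minus Q \<phi> = (\<lambda>\<theta> x. Lim at_bot (\<lambda>y. shift_conj Q y \<phi> \<theta> x))"

definition cont_on_below ::
  "('m::topological_space, 'n::finite) state \<Rightarrow> (('m, 'n) state \<Rightarrow> ('m, 'n) state) \<Rightarrow> bool" where
  "cont_on_below \<psi> P \<longleftrightarrow>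
    continuous_map (subtopology C_top (C_below \<psi>)) (subtopology C_top C_plus) P"

definition A1 :: "(('m::topological_space, 'n::finite) state \<Rightarrow> ('m, 'n) state) \<Rightarrow> bool" where
  "A1 Q \<longleftrightarrow> (\<forall>\<phi>\<in>C_plus. \<forall>y\<ge>0. Q (shift (- y) \<phi>) \<le> shift (- y) (Q \<phi>))"

definition A2 :: "(('m::topological_space, 'n::finite) state \<Rightarrow> ('m, 'n) state) \<Rightarrow> bool" where
  "A2 Q \<longleftrightarrow> (\<forall>r\<in>Int_pos. cont_on_below (vec_state r) Q \<and>
    (\<forall>\<phi>\<in>C_below (vec_state r). \<forall>\<psi>\<in>C_below (vec_state r). \<phi> \<le> \<psi> \<longrightarrow> Q \<phi> \<le> Q \<psi>))"

definition A3 :: "(('m::topological_space, 'n::finite) state \<Rightarrow> ('m, 'n) state) \<Rightarrow> bool" where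
  "A3 Q \<longleftrightarrow> (\<forall>\<phi>\<in>C_plus. \<forall>n.
    limitin C_top (\<lambda>y. shift_conj (Q ^^ n) y \<phi>) ((lim_plus Q ^^ n) \<phi>) at_top \<and>
    limitin C_top (\<lambda>y. shift_conj (Q ^^ n) y \<phi>) ((lim_minus Q ^^ n) \<phi>) at_bot)"

definition A4 ::
  "(('m::topological_space, 'n::finite) state \<Rightarrow> ('m, 'n) state) \<Rightarrow> ('m \<Rightarrow> real ^ 'n) \<Rightarrow> bool" where
  "A4 Q rstar \<longleftrightarrow>
    (\<forall>r\<in>Int_pos. cont_on_below (vec_state r) (lim_plus Q) \<and> cont_on_below (vec_state r) (lim_minus Q))
    \<and> lim_plus Q C_zero = C_zero
    \<and> rstar \<in> Int_Y_plus \<and> lim_plus Q (Y_state rstar) = Y_state rstar"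

definition SP :: "(('m::topological_space, 'n::finite) state \<Rightarrow> ('m, 'n) state) \<Rightarrow> bool" where
  "SP Q \<longleftrightarrow> (\<exists>N>0. \<forall>n\<ge>N. \<forall>\<theta>. \<forall>x>0. \<forall>\<phi>\<in>C_plus - {C_zero}. (Q ^^ n) \<phi> \<theta> x \<in> Int_pos)"

text \<open>
  The maximum over a set, with value \<open>0\<close> on the empty set. It is only applied to bounded
  continuous functions on compact intervals, where the supremum is attained.
\<close>

definition max0 :: "real set \<Rightarrow> (real \<Rightarrow> real) \<Rightarrow> real" where
  "max0 S f = (if S = {} then 0 else (SUP x\<in>S. f x))"

text \<open>\<open>UC P c\<^sub>- c\<^sub>+ r\<close> is the property \<open>(UC)\<close> of \<open>P\<close> for the given constants and the limit \<open>r\<close>.\<close>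

definition UC ::
  "(('m::topological_space, 'n::finite) state \<Rightarrow> ('m, 'n) state) \<Rightarrow> real \<Rightarrow> real
    \<Rightarrow> ('m \<Rightarrow> real ^ 'n) \<Rightarrow> bool" where
  "UC P cm cp r \<longleftrightarrow> 0 < cp + cm \<and>
    (\<forall>\<epsilon>\<in>{0<..<(cp + cm) / 2}. \<forall>\<phi>\<in>C_plus - {C_zero}.
      (\<lambda>n. max0 {real n * (- cm + \<epsilon>)..real n * (cp - \<epsilon>)}
             (\<lambda>x. Y_norm (\<lambda>\<theta>. (P ^^ n) \<phi> \<theta> x - r \<theta>))) \<longlonglongrightarrow> 0)"

definition subhomogeneous_on ::
  "('m, 'n::finite) state set \<Rightarrow> (('m, 'n) state \<Rightarrow> ('m, 'n) state) \<Rightarrow> bool" where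
  "subhomogeneous_on S Q \<longleftrightarrow> (\<forall>\<kappa>\<in>{0..1}. \<forall>\<phi>\<in>S.
    (\<lambda>\<theta> x. \<kappa> *\<^sub>R Q \<phi> \<theta> x) \<le> Q (\<lambda>\<theta> x. \<kappa> *\<^sub>R \<phi> \<theta> x))"

text \<open>
  \<open>(ASH-UC-SP)\<close> for given sequences of speeds, of equilibria and of maps. Since each \<open>Q\<^sub>l\<close>
  satisfies \<open>(A1)\<close> and \<open>(A2)\<close>, the map called \<open>Q\<^sub>l\<^sup>+\<close> in the paper is \<open>lim_plus (Ql l)\<close>.
\<close>

definition ASH_UC_SP ::
  "(('m::topological_space, 'n::finite) state \<Rightarrow> ('m, 'n) state) \<Rightarrow> ('m \<Rightarrow> real ^ 'n)
    \<Rightarrow> (nat \<Rightarrow> real) \<Rightarrow> (nat \<Rightarrow> real) \<Rightarrow> (nat \<Rightarrow> 'm \<Rightarrow> real ^ 'n)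
    \<Rightarrow> (nat \<Rightarrow> ('m, 'n) state \<Rightarrow> ('m, 'n) state) \<Rightarrow> bool" where
  "ASH_UC_SP Q rstar cm cp r Ql \<longleftrightarrow> (\<forall>l\<ge>1.
    Ql l \<in> C_plus \<rightarrow> C_plus \<and> r l \<in> Int_Y_plus \<and>
    A1 (Ql l) \<and> A2 (Ql l) \<and> Ql l C_zero = C_zero \<and>
    (\<forall>\<phi>\<in>C_below (Y_state rstar). Ql l \<phi> \<le> Q \<phi>) \<and>
    (\<forall>\<phi>\<in>C_plus. limitin C_top (\<lambda>y. shift_conj (Ql l) y \<phi>) (lim_plus (Ql l) \<phi>) at_top) \<and>
    lim_plus (Ql l) (Y_state (r l)) = Y_state (r l) \<and> r l \<le> rstar \<and>
    subhomogeneous_on (C_below (Y_state (r l))) (Ql l) \<and>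
    SP (Ql l) \<and> UC (lim_plus (Ql l)) (cm l) (cp l) (r l))"

end

theory Submission
  imports Defs
begin

text \<open>
  Far to the right, \<open>Q\<close> behaves like its limit map \<open>Q\<^sub>+ = lim_plus Q\<close>, whose spreading is known by
  \<open>(UC)\<close>. The upper estimate is immediate: \<open>(A1)\<close> makes \<open>shift_conj Q y\<close> increase to \<open>Q\<^sub>+\<close>, hence
  \<open>Q \<le> Q\<^sub>+\<close> and, by monotonicity, \<open>Q\<^sup>n \<phi> \<le> Q\<^sub>+\<^sup>n \<phi>\<close>, which is close to \<open>r\<^sup>*\<close> on the window.

  The lower estimate is obtained by comparison with tents, that is, multiples of \<open>r\<^sup>*\<close> cut off at
  distance \<open>1\<close> from a centre. By \<open>(UC)\<close>, some power \<open>Q\<^sub>+\<^sup>k\<close> lifts a tent of any height \<open>s > 0\<close> to height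
  \<open>t < 1\<close> around every point that moves with a velocity strictly between \<open>- c\<^sub>-\<close> and \<open>c\<^sub>+\<close>. Because
  the iterates converge locally uniformly to those of \<open>Q\<^sub>+\<close> (lemma \<open>shift_conj_funpow_loc_unif\<close>), the
  same is true of \<open>Q\<^sup>k\<close> when the tent starts far enough to the right (lemma \<open>tent_spreads\<close>). For
  \<open>s = t\<close> the step can be repeated, and if the velocity is nonnegative the tents never leave the
  region in which the step is valid (lemma \<open>tent_travels\<close>).

  It remains to place a first tent under the orbit of \<open>\<phi>\<close>. The distance from which the lifting works
  depends on the height, so what is required is one height \<open>\<kappa>\<close> that the orbit dominates arbitrarily far
  to the right; this persistence suffices by lemma \<open>spreading_of_persistent\<close>. If \<open>Q\<close> is
  subhomogeneous, a traveling tent may be scaled down without changing the place from which it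
  travels, and strong positivity provides a sufficiently low tent at that place
  (lemma \<open>persistent_of_subhomogeneous\<close>). In the other case the same argument applies to one map
  \<open>Q\<^sub>l \<le> Q\<close> whose rightward speed is positive, and persistence passes to \<open>Q\<close> by comparison
  (lemma \<open>persistent_of_minorant\<close>).
\<close>

section \<open>Local uniform convergence and the topology of \<open>C\<close>\<close>

text \<open>
  On uniformly bounded sets the topology of \<open>C\<close> is that of uniform convergence on the strips
  \<open>\<bar>x\<bar> \<le> K\<close>. This form is visibly invariant under shifts, and pointwise
  limits and comparisons are read off from it.
\<close>

definition loc_unif ::
  "('i \<Rightarrow> ('m, 'n::finite) state) \<Rightarrow> ('m, 'n) state \<Rightarrow> 'i filter \<Rightarrow> bool" where
  "loc_unif f l F \<longleftrightarrow>
    (\<forall>K. \<forall>\<eta>>0. \<forall>\<^sub>F i in F. \<forall>\<theta> x. \<bar>x\<bar> \<le> K \<longrightarrow> norm (f i \<theta> x - l \<theta> x) < \<eta>)"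

lemma loc_unifD:
  "loc_unif f l F \<Longrightarrow> 0 < \<eta> \<Longrightarrow> \<forall>\<^sub>F i in F. \<forall>\<theta> x. \<bar>x\<bar> \<le> K \<longrightarrow> norm (f i \<theta> x - l \<theta> x) < \<eta>"
  by (simp add: loc_unif_def)

lemma loc_unif_tendsto: "loc_unif f l F \<Longrightarrow> ((\<lambda>i. f i \<theta> x) \<longlongrightarrow> l \<theta> x) F"
  by (rule tendstoI) (drule loc_unifD[where K = "\<bar>x\<bar>"], auto simp: dist_norm elim: eventually_mono)

lemma loc_unif_shift:
  assumes "loc_unif f l F"
  shows "loc_unif (\<lambda>i. shift y (f i)) (shift y l) F"
  unfolding loc_unif_def
proof (intro allI impI)
  fix K \<eta> :: real assume "0 < \<eta>"
  then have "\<forall>\<^sub>F i in F. \<forall>\<theta> x. \<bar>x\<bar> \<le> K + \<bar>y\<bar> \<longrightarrow> norm (f i \<theta> x - l \<theta> x) < \<eta>"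
    by (rule loc_unifD[OF assms])
  then show "\<forall>\<^sub>F i in F. \<forall>\<theta> x. \<bar>x\<bar> \<le> K \<longrightarrow> norm (shift y (f i) \<theta> x - shift y l \<theta> x) < \<eta>"
    by eventually_elim (auto simp: shift_def)
qed

lemma limitin_C_top_iff:
  "limitin C_top f l F \<longleftrightarrow>
    l \<in> C_space \<and> (\<forall>\<epsilon>>0. \<forall>\<^sub>F i in F. f i \<in> C_space \<and> C_dist (f i) l < \<epsilon>)"
  unfolding C_top_def by (rule Metric_space.limitin_metric[OF Metric_space_C])

text \<open>
  A point with \<open>\<bar>x\<bar> \<le> k + 1\<close> carries weight at least \<open>(1/2) ^ Suc k\<close> in the norm.
\<close>

lemma limitin_C_top_imp_loc_unif:
  assumes "limitin C_top f l F"
  shows "loc_unif f l F"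
  unfolding loc_unif_def
proof (intro allI impI)
  fix K \<eta> :: real assume \<eta>: "0 < \<eta>"
  obtain k where "K \<le> real k" using real_arch_simple by blast
  then have k: "\<bar>x\<bar> \<le> real (Suc k)" if "\<bar>x\<bar> \<le> K" for x using that by simp
  have l: "l \<in> C_space" using assms by (simp add: limitin_C_top_iff)
  have "\<forall>\<^sub>F i in F. f i \<in> C_space \<and> C_dist (f i) l < (1/2) ^ Suc k * \<eta>"
    using assms \<eta> unfolding limitin_C_top_iff by (meson mult_pos_pos half_gt_zero zero_less_power zero_less_divide_1_iff zero_less_numeral)
  then show "\<forall>\<^sub>F i in F. \<forall>\<theta> x. \<bar>x\<bar> \<le> K \<longrightarrow> norm (f i \<theta> x - l \<theta> x) < \<eta>"
  proof (eventually_elim, intro allI impI)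
    fix i \<theta> x
    assume i: "f i \<in> C_space \<and> C_dist (f i) l < (1/2) ^ Suc k * \<eta>" and x: "\<bar>x\<bar> \<le> K"
    obtain B where B: "\<And>\<theta> x. norm (f i \<theta> x - l \<theta> x) \<le> B"
      using C_space_diff_bound i l by blast
    have "(1/2) ^ Suc k * norm (f i \<theta> x - l \<theta> x) \<le> X_norm (\<lambda>x. f i \<theta> x - l \<theta> x)"
      by (rule X_norm_ge[OF B k[OF x]])
    also have "\<dots> \<le> C_norm (\<lambda>\<theta> x. f i \<theta> x - l \<theta> x)"
      by (rule C_norm_ge[of "\<lambda>\<theta> x. f i \<theta> x - l \<theta> x", OF B])
    also have "\<dots> < (1/2) ^ Suc k * \<eta>" using conjunct1[OF i] conjunct2[OF i] l by (simp add: C_dist_def del: power_Suc)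
    finally show "norm (f i \<theta> x - l \<theta> x) < \<eta>" by simp
  qed
qed

text \<open>
  The weights beyond the \<open>k\<close>-th add up to \<open>2\<^sup>-\<^sup>k\<close>, so a function that is small on a large interval
  and bounded elsewhere has small norm.
\<close>

lemma X_norm_le_split:
  fixes u :: "real \<Rightarrow> real ^ 'n"
  assumes A: "\<And>x. norm (u x) \<le> A" and \<eta>: "\<And>x. \<bar>x\<bar> \<le> real k \<Longrightarrow> norm (u x) \<le> \<eta>"
  shows "X_norm u \<le> \<eta> + (1/2) ^ k * A"
proof -
  let ?s = "\<lambda>n. SUP x\<in>{- real (Suc n)..real (Suc n)}. norm (u x)"
  let ?t = "\<lambda>n. if n < k then 0 else (1/2) ^ Suc n * A"
  have "0 \<le> \<eta>" using \<eta>[of 0] order_trans[OF norm_ge_zero] by auto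
  have "0 \<le> A" using A[of 0] norm_ge_zero[of "u 0"] by linarith
  have geo: "(\<lambda>n. (1/2) ^ Suc n * \<eta>) sums (1 * \<eta>)"
    by (intro sums_mult2 power_half_series)
  have "(\<lambda>n. (1/2) ^ k * ((1/2) ^ Suc n * A)) sums ((1/2) ^ k * (1 * A))"
    by (intro sums_mult sums_mult2 power_half_series)
  then have "(\<lambda>n. ?t (n + k)) sums ((1/2) ^ k * A)"
    by (simp add: power_add mult_ac)
  then have geo2: "?t sums ((1/2) ^ k * A)"
    by (subst (asm) sums_iff_shift) simp
  have s: "?s n \<le> A" "n < k \<Longrightarrow> ?s n \<le> \<eta>" for n
    by (rule cSUP_least; use A \<eta> in auto)+
  have "X_norm u \<le> (\<Sum>n. (1/2) ^ Suc n * \<eta> + ?t n)"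
    unfolding X_norm_def
  proof (intro suminf_le summable_add)
    fix n
    show "(1/2) ^ Suc n * ?s n \<le> (1/2) ^ Suc n * \<eta> + ?t n"
    proof (cases "n < k")
      case True
      then show ?thesis using mult_left_mono[OF s(2)[OF True], of "(1/2) ^ Suc n"] by simp
    next
      case False
      have "0 \<le> (1/2) ^ Suc n * \<eta>" using \<open>0 \<le> \<eta>\<close> by simp
      moreover have "(1/2) ^ Suc n * ?s n \<le> (1/2) ^ Suc n * A"
        by (rule mult_left_mono[OF s(1)]) simp
      ultimately show ?thesis unfolding if_not_P[OF False] by linarith
    qed
  qed (use X_norm_summable[OF A] sums_summable[OF geo] sums_summable[OF geo2] in auto)
  also have "\<dots> = \<eta> + (1/2) ^ k * A"
    using sums_unique[OF sums_add[OF geo geo2]] by simp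
  finally show ?thesis .
qed

lemma loc_unif_imp_limitin_C_top:
  fixes f :: "'i \<Rightarrow> ('m::topological_space, 'n::finite) state"
  assumes lim: "loc_unif f l F" and f: "\<And>i. f i \<in> C_space" and l: "l \<in> C_space"
    and B: "\<And>i \<theta> x. norm (f i \<theta> x) \<le> B"
  shows "limitin C_top f l F"
  unfolding limitin_C_top_iff
proof (intro conjI allI impI l)
  fix \<epsilon> :: real assume \<epsilon>: "0 < \<epsilon>"
  obtain B' where B': "\<And>\<theta> x. norm (l \<theta> x) \<le> B'" using C_space_bound[OF l] by blast
  define A where "A = B + B'"
  have A: "norm (f i \<theta> x - l \<theta> x) \<le> A" for i \<theta> x
    unfolding A_def by (meson B B' add_mono norm_triangle_ineq4 order_trans)
  have "(\<lambda>k. (1/2) ^ k * A) \<longlonglongrightarrow> 0 * A"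
    by (intro tendsto_intros LIMSEQ_realpow_zero) auto
  then obtain k where k: "(1/2) ^ k * A < \<epsilon> / 2"
    using \<epsilon> order_tendstoD(2)[of _ "0 * A" sequentially "\<epsilon>/2"]
    by (auto simp: eventually_sequentially)
  have "\<forall>\<^sub>F i in F. \<forall>\<theta> x. \<bar>x\<bar> \<le> real k \<longrightarrow> norm (f i \<theta> x - l \<theta> x) < \<epsilon>/4"
    using \<epsilon> by (intro loc_unifD[OF lim]) simp
  then show "\<forall>\<^sub>F i in F. f i \<in> C_space \<and> C_dist (f i) l < \<epsilon>"
  proof eventually_elim
    fix i assume i: "\<forall>\<theta> x. \<bar>x\<bar> \<le> real k \<longrightarrow> norm (f i \<theta> x - l \<theta> x) < \<epsilon>/4"
    have "X_norm (\<lambda>x. f i \<theta> x - l \<theta> x) \<le> \<epsilon>/4 + (1/2) ^ k * A" for \<theta>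
      by (rule X_norm_le_split[OF A]) (use i in \<open>auto intro: less_imp_le\<close>)
    then have "C_norm (\<lambda>\<theta> x. f i \<theta> x - l \<theta> x) \<le> \<epsilon>/4 + (1/2) ^ k * A"
      unfolding C_norm_def by (intro cSUP_least) auto
    then show "f i \<in> C_space \<and> C_dist (f i) l < \<epsilon>"
      using k \<epsilon> f[of i] l by (simp add: C_dist_def)
  qed
qed

section \<open>The cone of nonnegative states\<close>

lemma Int_pos_iff: "(v :: real ^ 'n) \<in> Int_pos \<longleftrightarrow> (\<forall>i. 0 < v $ i)"
proof
  assume "v \<in> Int_pos"
  then obtain e where e: "0 < e" "ball v e \<subseteq> {w. 0 \<le> w}"
    unfolding Int_pos_def mem_interior by blast
  show "\<forall>i. 0 < v $ i"
  proof
    fix i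
    have "v - axis i (e/2) \<in> ball v e" using e by (simp add: dist_norm norm_eq_sqrt_inner inner_axis_axis flip: power2_eq_square)
    then have "0 \<le> v - axis i (e/2)" using e by blast
    then have "0 \<le> (v - axis i (e/2)) $ i" unfolding less_eq_vec_def by (metis zero_index)
    then show "0 < v $ i" using e by (simp add: axis_def)
  qed
next
  assume "\<forall>i. 0 < v $ i"
  moreover have "open {w :: real ^ 'n. \<forall>i. 0 < w $ i}"
    unfolding Collect_all_eq by (intro open_INT ballI open_Collect_less continuous_intros) simp
  ultimately show "v \<in> Int_pos"
    unfolding Int_pos_def by (intro interiorI[of "{w. \<forall>i. 0 < w $ i}"]) (auto simp: less_eq_vec_def less_imp_le)
qed

text \<open>
  Every component attains its minimum, and there are finitely many components. This turns strict
  positivity on \<open>M\<close>, or on \<open>M\<close> times a compact interval, into a bound from below.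
\<close>

lemma compact_Int_pos_lower_bound:
  fixes f :: "'a::topological_space \<Rightarrow> real ^ 'n"
  assumes "compact S" "continuous_on S f" "\<And>x. x \<in> S \<Longrightarrow> f x \<in> Int_pos"
  obtains c where "0 < c" "\<And>x i. x \<in> S \<Longrightarrow> c \<le> f x $ i"
proof (cases "S = {}")
  case False
  have "\<forall>i. \<exists>c>0. \<forall>x\<in>S. c \<le> f x $ i"
  proof
    fix i
    obtain z where "z \<in> S" "\<forall>x\<in>S. f z $ i \<le> f x $ i"
      using continuous_attains_inf[OF assms(1) False, of "\<lambda>x. f x $ i"] assms(2)
      by (auto intro: continuous_intros)
    then show "\<exists>c>0. \<forall>x\<in>S. c \<le> f x $ i"
      using assms(3) Int_pos_iff by blast
  qed
  then obtain c where c: "\<And>i. 0 < c i" "\<And>i x. x \<in> S \<Longrightarrow> c i \<le> f x $ i" by metis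
  show thesis
  proof (rule that)
    show "0 < Min (range c)" using c(1) by (subst Min_gr_iff) auto
    show "Min (range c) \<le> f x $ i" if "x \<in> S" for x i
      by (rule order_trans[OF Min_le c(2)[OF that]]) auto
  qed
qed (use that[of 1] in auto)

lemma C_plus_C_space: "\<phi> \<in> C_plus \<Longrightarrow> \<phi> \<in> C_space"
  and C_plus_nonneg: "\<phi> \<in> C_plus \<Longrightarrow> 0 \<le> \<phi> \<theta> x $ i"
  by (simp_all add: C_plus_def less_eq_vec_def)

lemma C_plusI: "\<phi> \<in> C_space \<Longrightarrow> (\<And>\<theta> x i. 0 \<le> \<phi> \<theta> x $ i) \<Longrightarrow> \<phi> \<in> C_plus"
  by (simp add: C_plus_def less_eq_vec_def)

lemma state_le_iff: "(\<phi> :: ('m, 'n::finite) state) \<le> \<psi> \<longleftrightarrow> (\<forall>\<theta> x i. \<phi> \<theta> x $ i \<le> \<psi> \<theta> x $ i)"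
  by (simp add: le_fun_def less_eq_vec_def)

text \<open>
  The continuity and monotonicity hypotheses speak of order intervals below a constant vector;
  boundedness makes them applicable on the whole cone.
\<close>

lemma C_plus_below_constant:
  assumes "\<phi> \<in> C_plus"
  obtains v where "v \<in> Int_pos" "\<phi> \<in> C_below (vec_state v)"
proof -
  obtain B where B: "\<And>\<theta> x. norm (\<phi> \<theta> x) \<le> B"
    using C_space_bound[OF C_plus_C_space[OF assms]] by blast
  have B0: "0 \<le> B" using B[of undefined 0] norm_ge_zero order_trans by blast
  show thesis
  proof
    show "(\<chi> i. B + 1) \<in> Int_pos" using B0 by (simp add: Int_pos_iff)
    have "\<phi> \<theta> x $ i \<le> B + 1" for \<theta> x i
      using B[of \<theta> x] component_le_norm_cart[of "\<phi> \<theta> x" i] by linarith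
    then show "\<phi> \<in> C_below (vec_state (\<chi> i. B + 1))"
      using assms by (simp add: C_below_def vec_state_def C_zero_def state_le_iff C_plus_def less_eq_vec_def)
  qed
qed

lemma C_below_iff: "\<phi> \<in> C_below \<psi> \<longleftrightarrow> \<phi> \<in> C_plus \<and> \<phi> \<le> \<psi>"
  unfolding C_below_def C_plus_def C_zero_def le_fun_def by blast

lemma shift_add: "shift y (shift z \<phi>) = shift (y + z) \<phi>"
  by (simp add: shift_def algebra_simps)

lemma shift_0 [simp]: "shift 0 \<phi> = \<phi>"
  by (simp add: shift_def)

lemma shift_mono: "\<phi> \<le> \<psi> \<Longrightarrow> shift y \<phi> \<le> shift y \<psi>"
  by (simp add: shift_def le_fun_def)

lemma shift_C_space:
  fixes \<phi> :: "('a::topological_space, 'n::finite) state"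
  shows "\<phi> \<in> C_space \<Longrightarrow> shift y \<phi> \<in> C_space"
proof -
  assume \<phi>: "\<phi> \<in> C_space"
  have "continuous_on UNIV (\<lambda>(\<theta>, x). \<phi> \<theta> x)" using \<phi> by (simp add: C_space_def)
  moreover have "continuous_on UNIV (\<lambda>p :: 'a \<times> real. (fst p, snd p - y))"
    by (intro continuous_intros)
  ultimately have "continuous_on UNIV (\<lambda>p. (\<lambda>(\<theta>, x). \<phi> \<theta> x) (fst p, snd p - y))"
    by (rule continuous_on_compose2) simp
  moreover have "bounded (range (\<lambda>(\<theta>, x). shift y \<phi> \<theta> x))"
    by (rule bounded_subset[of "range (\<lambda>(\<theta>, x). \<phi> \<theta> x)"]) (use \<phi> in \<open>auto simp: C_space_def shift_def\<close>)
  ultimately show ?thesis by (simp add: C_space_def shift_def case_prod_unfold)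
qed

lemma shift_C_plus: "\<phi> \<in> C_plus \<Longrightarrow> shift y \<phi> \<in> C_plus"
  by (rule C_plusI[OF shift_C_space[OF C_plus_C_space]]) (simp_all add: shift_def C_plus_nonneg)

lemma scale_C_plus:
  assumes "\<phi> \<in> C_plus" "0 \<le> t"
  shows "(\<lambda>\<theta> x. t *\<^sub>R \<phi> \<theta> x) \<in> C_plus"
proof -
  obtain B where B: "\<And>\<theta> x. norm (\<phi> \<theta> x) \<le> B"
    using C_space_bound[OF C_plus_C_space[OF assms(1)]] by blast
  have "bounded (range (\<lambda>(\<theta>, x). t *\<^sub>R \<phi> \<theta> x))"
    unfolding bounded_iff using B assms(2) by (auto intro!: exI[of _ "t * B"] mult_left_mono)
  moreover have "continuous_on UNIV (\<lambda>(\<theta>, x). t *\<^sub>R \<phi> \<theta> x)"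
    using C_plus_C_space[OF assms(1)] unfolding C_space_def case_prod_unfold
    by (intro continuous_intros) simp
  ultimately show ?thesis
    using assms by (intro C_plusI) (simp_all add: C_space_def C_plus_nonneg)
qed

section \<open>Monotone maps with a limit at the right end\<close>

lemma norm_le_of_between:
  fixes u v w :: "real ^ 'n"
  assumes "u \<le> v" "v \<le> w"
  shows "norm (w - v) \<le> norm (w - u)"
proof (rule norm_le_componentwise_cart)
  fix i
  have "u $ i \<le> v $ i" "v $ i \<le> w $ i" using assms by (auto simp: less_eq_vec_def)
  then show "norm ((w - v) $ i) \<le> norm ((w - u) $ i)" by simp
qed

text \<open>
  These hypotheses are shared by \<open>Q\<close> and by each approximating map \<open>Q\<^sub>l\<close>. They concern one
  application of the map; convergence of the iterates is derived from them.
\<close>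

locale rightward_limit_map =
  fixes Q :: "('m::topological_space, 'n::finite) state \<Rightarrow> ('m, 'n) state"
  assumes maps: "Q \<in> C_plus \<rightarrow> C_plus"
    and A1: "A1 Q"
    and A2: "A2 Q"
    and conv: "\<phi> \<in> C_plus \<Longrightarrow> limitin C_top (\<lambda>y. shift_conj Q y \<phi>) (lim_plus Q \<phi>) at_top"
begin

lemma Q_C_plus: "\<phi> \<in> C_plus \<Longrightarrow> Q \<phi> \<in> C_plus"
  using maps by blast

lemma Q_mono:
  assumes "\<phi> \<in> C_plus" "\<psi> \<in> C_plus" "\<phi> \<le> \<psi>"
  shows "Q \<phi> \<le> Q \<psi>"
proof -
  obtain v where v: "v \<in> Int_pos" "\<psi> \<in> C_below (vec_state v)"
    using C_plus_below_constant[OF assms(2)] by blast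
  have "\<phi> \<le> vec_state v" using assms(3) v(2) unfolding C_below_iff by (blast intro: order_trans)
  then have "\<phi> \<in> C_below (vec_state v)" using assms(1) by (simp add: C_below_iff)
  then show ?thesis using A2 v assms(3) unfolding A2_def by blast
qed

lemma Q_funpow_C_plus: "\<phi> \<in> C_plus \<Longrightarrow> (Q ^^ n) \<phi> \<in> C_plus"
  by (induction n) (simp_all add: Q_C_plus)

lemma Q_funpow_mono: "\<phi> \<in> C_plus \<Longrightarrow> \<psi> \<in> C_plus \<Longrightarrow> \<phi> \<le> \<psi> \<Longrightarrow> (Q ^^ n) \<phi> \<le> (Q ^^ n) \<psi>"
  by (induction n) (simp_all add: Q_mono Q_funpow_C_plus)

lemma shift_conj_C_plus: "\<phi> \<in> C_plus \<Longrightarrow> shift_conj Q y \<phi> \<in> C_plus"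
  by (simp add: shift_conj_def shift_C_plus Q_C_plus)

lemma shift_conj_mono:
  "\<phi> \<in> C_plus \<Longrightarrow> \<psi> \<in> C_plus \<Longrightarrow> \<phi> \<le> \<psi> \<Longrightarrow> shift_conj Q y \<phi> \<le> shift_conj Q y \<psi>"
  by (simp add: shift_conj_def shift_mono shift_C_plus Q_mono)

text \<open>
  This is \<open>(A1)\<close> for the displacement \<open>z - y\<close>, applied to the state shifted by \<open>z\<close>.
\<close>

lemma shift_conj_increasing:
  assumes "\<phi> \<in> C_plus" "y \<le> z"
  shows "shift_conj Q y \<phi> \<le> shift_conj Q z \<phi>"
proof -
  have "Q (shift (- (z - y)) (shift z \<phi>)) \<le> shift (- (z - y)) (Q (shift z \<phi>))"
    using A1 shift_C_plus[OF assms(1)] diff_ge_0_iff_ge[THEN iffD2, OF assms(2)]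
    unfolding A1_def by blast
  then have "shift (- y) (Q (shift y \<phi>)) \<le> shift (- y) (shift (- (z - y)) (Q (shift z \<phi>)))"
    by (intro shift_mono) (simp add: shift_add)
  then show ?thesis by (simp add: shift_conj_def shift_add)
qed

lemma shift_conj_loc_unif: "\<phi> \<in> C_plus \<Longrightarrow> loc_unif (\<lambda>y. shift_conj Q y \<phi>) (lim_plus Q \<phi>) at_top"
  by (rule limitin_C_top_imp_loc_unif[OF conv])

lemma shift_conj_tendsto:
  "\<phi> \<in> C_plus \<Longrightarrow> ((\<lambda>y. shift_conj Q y \<phi> \<theta> x $ i) \<longlongrightarrow> lim_plus Q \<phi> \<theta> x $ i) at_top"
  by (intro tendsto_vec_nth loc_unif_tendsto shift_conj_loc_unif)

lemma shift_conj_le_lim_plus: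
  assumes "\<phi> \<in> C_plus"
  shows "shift_conj Q y \<phi> \<le> lim_plus Q \<phi>"
  unfolding state_le_iff
proof (intro allI)
  fix \<theta> x i
  have "\<forall>\<^sub>F z in at_top. shift_conj Q y \<phi> \<theta> x $ i \<le> shift_conj Q z \<phi> \<theta> x $ i"
    using eventually_ge_at_top[of y]
  proof eventually_elim
    fix z assume "y \<le> z"
    then show "shift_conj Q y \<phi> \<theta> x $ i \<le> shift_conj Q z \<phi> \<theta> x $ i"
      using shift_conj_increasing[OF assms] unfolding state_le_iff by blast
  qed
  then show "shift_conj Q y \<phi> \<theta> x $ i \<le> lim_plus Q \<phi> \<theta> x $ i"
    by (rule tendsto_lowerbound[OF shift_conj_tendsto[OF assms]]) simp
qed

lemma Q_le_lim_plus: "\<phi> \<in> C_plus \<Longrightarrow> Q \<phi> \<le> lim_plus Q \<phi>"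
  using shift_conj_le_lim_plus[of \<phi> 0] by (simp add: shift_conj_def)

lemma lim_plus_C_plus: "\<phi> \<in> C_plus \<Longrightarrow> lim_plus Q \<phi> \<in> C_plus"
proof (rule C_plusI)
  assume \<phi>: "\<phi> \<in> C_plus"
  then show "lim_plus Q \<phi> \<in> C_space" using conv limitin_C_top_iff by blast
  show "0 \<le> lim_plus Q \<phi> \<theta> x $ i" for \<theta> x i
    using Q_le_lim_plus[OF \<phi>] C_plus_nonneg[OF Q_C_plus[OF \<phi>]]
    unfolding state_le_iff by (blast intro: order_trans)
qed

lemma lim_plus_mono:
  assumes "\<phi> \<in> C_plus" "\<psi> \<in> C_plus" "\<phi> \<le> \<psi>"
  shows "lim_plus Q \<phi> \<le> lim_plus Q \<psi>"
  unfolding state_le_iff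
proof (intro allI)
  fix \<theta> x i
  have "shift_conj Q y \<phi> \<le> lim_plus Q \<psi>" for y
    using shift_conj_mono[OF assms] shift_conj_le_lim_plus[OF assms(2)] by (rule order_trans)
  then have "\<forall>\<^sub>F y in at_top. shift_conj Q y \<phi> \<theta> x $ i \<le> lim_plus Q \<psi> \<theta> x $ i"
    by (simp add: state_le_iff)
  then show "lim_plus Q \<phi> \<theta> x $ i \<le> lim_plus Q \<psi> \<theta> x $ i"
    by (rule tendsto_upperbound[OF shift_conj_tendsto[OF assms(1)]]) simp
qed

lemma lim_plus_funpow_C_plus: "\<phi> \<in> C_plus \<Longrightarrow> (lim_plus Q ^^ n) \<phi> \<in> C_plus"
  by (induction n) (simp_all add: lim_plus_C_plus)

lemma shift_conj_funpow_C_plus: "\<phi> \<in> C_plus \<Longrightarrow> (shift_conj Q y ^^ n) \<phi> \<in> C_plus"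
  by (induction n) (simp_all add: shift_conj_C_plus)

lemma shift_conj_funpow_le:
  assumes "\<phi> \<in> C_plus"
  shows "(shift_conj Q y ^^ n) \<phi> \<le> (lim_plus Q ^^ n) \<phi>"
proof (induction n)
  case (Suc n)
  have "shift_conj Q y ((shift_conj Q y ^^ n) \<phi>) \<le> lim_plus Q ((shift_conj Q y ^^ n) \<phi>)"
    by (intro shift_conj_le_lim_plus shift_conj_funpow_C_plus assms)
  also have "\<dots> \<le> lim_plus Q ((lim_plus Q ^^ n) \<phi>)"
    by (intro lim_plus_mono shift_conj_funpow_C_plus lim_plus_funpow_C_plus assms Suc.IH)
  finally show ?case by simp
qed simp

lemma shift_conj_0: "shift_conj Q 0 = Q"
  by (simp add: shift_conj_def fun_eq_iff)

lemma Q_funpow_le_lim_plus: "\<phi> \<in> C_plus \<Longrightarrow> (Q ^^ n) \<phi> \<le> (lim_plus Q ^^ n) \<phi>"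
  using shift_conj_funpow_le[of \<phi> n 0] by (simp add: shift_conj_0)

lemma shift_conj_funpow: "(shift_conj Q y ^^ n) \<phi> = shift_conj (Q ^^ n) y \<phi>"
  by (induction n) (simp_all add: shift_conj_def shift_add)

text \<open>
  A common upper bound \<open>\<psi>\<close> keeps the shifted states in one order interval, where \<open>(A2)\<close> provides
  continuity in \<open>C\<close>; the shift on either side respects local uniform convergence.
\<close>

lemma shift_conj_loc_unif_continuous:
  assumes f: "\<And>i. f i \<in> C_plus" "\<And>i. f i \<le> \<psi>" and \<psi>: "\<psi> \<in> C_plus" and lim: "loc_unif f \<psi> F"
  shows "loc_unif (\<lambda>i. shift_conj Q y (f i)) (shift_conj Q y \<psi>) F"
proof -
  obtain v where v: "v \<in> Int_pos" "shift y \<psi> \<in> C_below (vec_state v)"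
    using C_plus_below_constant[OF shift_C_plus[OF \<psi>]] by blast
  obtain B where B: "\<And>\<theta> x. norm (shift y \<psi> \<theta> x) \<le> B"
    using C_space_bound[OF C_plus_C_space[OF shift_C_plus[OF \<psi>]]] by blast
  define g where "g i = shift y (f i)" for i
  have g: "g i \<in> C_plus" "g i \<le> shift y \<psi>" for i
    unfolding g_def using f by (simp_all add: shift_C_plus shift_mono)
  have g_below: "g i \<in> C_below (vec_state v)" for i
    using g v(2) unfolding C_below_iff by (blast intro: order_trans)
  have gB: "norm (g i \<theta> x) \<le> B" for i \<theta> x
    by (rule order_trans[OF _ B[of \<theta> x]], rule norm_le_componentwise_cart)
      (use g(2) C_plus_nonneg[OF g(1)] in \<open>auto simp: state_le_iff intro: order_trans[OF _ abs_ge_self]\<close>)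
  have "loc_unif g (shift y \<psi>) F"
    unfolding g_def by (rule loc_unif_shift[OF lim])
  then have "limitin C_top g (shift y \<psi>) F"
    by (rule loc_unif_imp_limitin_C_top[OF _ C_plus_C_space[OF g(1)]
          C_plus_C_space[OF shift_C_plus[OF \<psi>]] gB])
  then have "limitin (subtopology C_top (C_below (vec_state v))) g (shift y \<psi>) F"
    using v(2) g_below by (simp add: limitin_subtopology)
  then have "limitin (subtopology C_top C_plus) (Q \<circ> g) (Q (shift y \<psi>)) F"
    using A2 v(1) unfolding A2_def cont_on_below_def by (blast intro: continuous_map_limit)
  then have "limitin C_top (Q \<circ> g) (Q (shift y \<psi>)) F"
    by (simp add: limitin_subtopology)
  then have "loc_unif (\<lambda>i. shift (- y) ((Q \<circ> g) i)) (shift (- y) (Q (shift y \<psi>))) F"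
    by (intro loc_unif_shift limitin_C_top_imp_loc_unif)
  then show ?thesis by (simp add: shift_conj_def g_def)
qed

text \<open>
  Write \<open>P\<^sub>y\<close> for \<open>shift_conj Q y\<close>. The iterates of \<open>P\<^sub>y\<close> stay below those of \<open>Q\<^sub>+\<close>. Let
  \<open>\<psi> = Q\<^sub>+\<^sup>n \<phi>\<close>; for the step from \<open>n\<close> to \<open>n + 1\<close> only a
  lower bound for \<open>P\<^sub>y (P\<^sub>y\<^sup>n \<phi>)\<close> is needed. Monotonicity in the shift allows the outer map to be
  frozen: for \<open>y \<ge> z\<close> it is at least \<open>P\<^sub>z (P\<^sub>y\<^sup>n \<phi>)\<close>, which tends to \<open>P\<^sub>z \<psi>\<close> by continuity of the
  single map \<open>P\<^sub>z\<close>, and \<open>P\<^sub>z \<psi>\<close> is close to \<open>Q\<^sub>+ \<psi>\<close> when \<open>z\<close> is large.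
\<close>

lemma shift_conj_funpow_loc_unif:
  assumes \<phi>: "\<phi> \<in> C_plus"
  shows "loc_unif (\<lambda>y. (shift_conj Q y ^^ n) \<phi>) ((lim_plus Q ^^ n) \<phi>) at_top"
proof (induction n)
  case 0
  show ?case by (simp add: loc_unif_def)
next
  case (Suc n)
  let ?\<psi> = "(lim_plus Q ^^ n) \<phi>" and ?f = "\<lambda>y. (shift_conj Q y ^^ n) \<phi>"
  have \<psi>: "?\<psi> \<in> C_plus" and f: "?f y \<in> C_plus" "?f y \<le> ?\<psi>" for y
    by (rule lim_plus_funpow_C_plus[OF \<phi>] shift_conj_funpow_C_plus[OF \<phi>]
        shift_conj_funpow_le[OF \<phi>])+
  show ?case
    unfolding loc_unif_def
  proof (intro allI impI)
    fix K \<eta> :: real assume \<eta>: "0 < \<eta>"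
    then have "\<forall>\<^sub>F z in at_top. \<forall>\<theta> x. \<bar>x\<bar> \<le> K \<longrightarrow>
        norm (shift_conj Q z ?\<psi> \<theta> x - lim_plus Q ?\<psi> \<theta> x) < \<eta>/2"
      by (intro loc_unifD[OF shift_conj_loc_unif[OF \<psi>]]) simp
    then obtain z where z: "\<And>\<theta> x. \<bar>x\<bar> \<le> K \<Longrightarrow>
        norm (shift_conj Q z ?\<psi> \<theta> x - lim_plus Q ?\<psi> \<theta> x) < \<eta>/2"
      using eventually_happens'[OF trivial_limit_at_top_linorder] by blast
    have "\<forall>\<^sub>F y in at_top. \<forall>\<theta> x. \<bar>x\<bar> \<le> K \<longrightarrow>
        norm (shift_conj Q z (?f y) \<theta> x - shift_conj Q z ?\<psi> \<theta> x) < \<eta>/2"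
      using \<eta> by (intro loc_unifD[OF shift_conj_loc_unif_continuous[OF f \<psi> Suc.IH]]) simp
    then show "\<forall>\<^sub>F y in at_top. \<forall>\<theta> x. \<bar>x\<bar> \<le> K \<longrightarrow>
        norm ((shift_conj Q y ^^ Suc n) \<phi> \<theta> x - (lim_plus Q ^^ Suc n) \<phi> \<theta> x) < \<eta>"
      using eventually_ge_at_top[of z]
    proof (eventually_elim, intro allI impI)
      fix y \<theta> x
      assume near: "\<forall>\<theta> x. \<bar>x\<bar> \<le> K \<longrightarrow>
          norm (shift_conj Q z (?f y) \<theta> x - shift_conj Q z ?\<psi> \<theta> x) < \<eta>/2"
        and "z \<le> y" and x: "\<bar>x\<bar> \<le> K"
      have low: "shift_conj Q z (?f y) \<le> shift_conj Q y (?f y)"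
        using f(1) \<open>z \<le> y\<close> by (rule shift_conj_increasing)
      have high: "shift_conj Q y (?f y) \<le> lim_plus Q ?\<psi>"
        using shift_conj_funpow_le[OF \<phi>, of "Suc n" y] by simp
      have "norm (lim_plus Q ?\<psi> \<theta> x - shift_conj Q y (?f y) \<theta> x)
          \<le> norm (lim_plus Q ?\<psi> \<theta> x - shift_conj Q z (?f y) \<theta> x)"
        using low high unfolding le_fun_def by (intro norm_le_of_between) blast+
      also have "\<dots> \<le> norm (shift_conj Q z ?\<psi> \<theta> x - lim_plus Q ?\<psi> \<theta> x)
          + norm (shift_conj Q z (?f y) \<theta> x - shift_conj Q z ?\<psi> \<theta> x)"
        using norm_triangle_ineq[of "lim_plus Q ?\<psi> \<theta> x - shift_conj Q z ?\<psi> \<theta> x"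
            "shift_conj Q z ?\<psi> \<theta> x - shift_conj Q z (?f y) \<theta> x"]
        by (simp add: norm_minus_commute)
      also have "\<dots> < \<eta>" using z[OF x, of \<theta>] near[rule_format, OF x, of \<theta>] by linarith
      finally show "norm ((shift_conj Q y ^^ Suc n) \<phi> \<theta> x - (lim_plus Q ^^ Suc n) \<phi> \<theta> x) < \<eta>"
        by (simp add: norm_minus_commute)
    qed
  qed
qed

text \<open>
  The same convergence seen from the original frame: \<open>Q\<close> acts on a profile placed far to the right
  as \<open>Q\<^sub>+\<close> acts on the unshifted profile.
\<close>

lemma Q_funpow_far_right:
  assumes "\<phi> \<in> C_plus" "0 < \<eta>"
  obtains y\<^sub>0 where "\<And>y \<theta> x. y\<^sub>0 \<le> y \<Longrightarrow> \<bar>x - y\<bar> \<le> K \<Longrightarrow>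
    norm ((Q ^^ n) (shift y \<phi>) \<theta> x - (lim_plus Q ^^ n) \<phi> \<theta> (x - y)) < \<eta>"
proof -
  obtain y\<^sub>0 where y\<^sub>0: "\<And>y \<theta> x. y\<^sub>0 \<le> y \<Longrightarrow> \<bar>x\<bar> \<le> K \<Longrightarrow>
      norm (shift_conj (Q ^^ n) y \<phi> \<theta> x - (lim_plus Q ^^ n) \<phi> \<theta> x) < \<eta>"
    using loc_unifD[OF shift_conj_funpow_loc_unif[OF assms(1), of n] assms(2), of K]
    unfolding eventually_at_top_linorder shift_conj_funpow by blast
  show thesis
  proof (rule that)
    fix y \<theta> x assume "y\<^sub>0 \<le> y" "\<bar>x - y\<bar> \<le> K"
    then show "norm ((Q ^^ n) (shift y \<phi>) \<theta> x - (lim_plus Q ^^ n) \<phi> \<theta> (x - y)) < \<eta>"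
      using y\<^sub>0[of y "x - y" \<theta>] by (simp add: shift_conj_def shift_def[of "- y"])
  qed
qed

end

section \<open>Tents\<close>

text \<open>
  A tent is a multiple of \<open>r\<close> cut off at distance \<open>1\<close> from its centre \<open>y\<close>. Its bounded support lets
  it fit under a state that is large only near \<open>y\<close>, and the value \<open>s\<close> times \<open>r\<close> at the centre
  transfers a bound on tents into a pointwise bound.
\<close>

definition tent :: "('m \<Rightarrow> real ^ 'n) \<Rightarrow> real \<Rightarrow> real \<Rightarrow> ('m, 'n::finite) state" where
  "tent r s y = (\<lambda>\<theta> x. (s * max 0 (1 - \<bar>x - y\<bar>)) *\<^sub>R r \<theta>)"

lemma tent_nth: "tent r s y \<theta> x $ i = s * max 0 (1 - \<bar>x - y\<bar>) * r \<theta> $ i"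
  by (simp add: tent_def)

lemma shift_tent: "shift z (tent r s y) = tent r s (z + y)"
  by (simp add: shift_def tent_def algebra_simps)

lemma scale_tent: "(\<lambda>\<theta> x. t *\<^sub>R tent r s y \<theta> x) = tent r (t * s) y"
  by (simp add: tent_def mult.assoc)

lemma Int_Y_plus_nth_pos: "r \<in> Int_Y_plus \<Longrightarrow> 0 < r \<theta> $ i"
  by (simp add: Int_Y_plus_def Int_pos_iff)

lemma Int_Y_plus_continuous: "r \<in> Int_Y_plus \<Longrightarrow> continuous_on UNIV r"
  by (simp add: Int_Y_plus_def Y_space_def)

lemma Int_Y_plus_lower_bound:
  fixes r :: "'m::topological_space \<Rightarrow> real ^ 'n::finite"
  assumes "compact (UNIV :: 'm set)" "r \<in> Int_Y_plus"
  obtains c where "0 < c" "\<And>\<theta> i. c \<le> r \<theta> $ i"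
proof -
  have "r \<theta> \<in> Int_pos" for \<theta> using assms(2) by (simp add: Int_Y_plus_def)
  then show thesis
    using compact_Int_pos_lower_bound[OF assms(1) Int_Y_plus_continuous[OF assms(2)]] that
    by (metis UNIV_I)
qed

lemma Int_Y_plus_upper_bound:
  fixes r :: "'m::topological_space \<Rightarrow> real ^ 'n::finite"
  assumes "compact (UNIV :: 'm set)" "r \<in> Int_Y_plus"
  obtains R where "\<And>\<theta>. norm (r \<theta>) \<le> R"
proof -
  have "bounded (range r)"
    by (intro compact_imp_bounded compact_continuous_image Int_Y_plus_continuous assms)
  then show thesis using that by (auto simp: bounded_iff)
qed

lemma Y_state_C_plus:
  fixes r :: "'m::topological_space \<Rightarrow> real ^ 'n::finite"
  assumes "compact (UNIV :: 'm set)" "r \<in> Int_Y_plus"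
  shows "Y_state r \<in> C_plus"
proof (rule C_plusI)
  obtain R where R: "\<And>\<theta>. norm (r \<theta>) \<le> R" by (rule Int_Y_plus_upper_bound[OF assms]) (rule that)
  have "bounded (range (\<lambda>(\<theta>, x :: real). r \<theta>))" using R by (auto simp: bounded_iff)
  moreover have "continuous_on UNIV (\<lambda>(\<theta>, x :: real). r \<theta>)"
    unfolding case_prod_unfold
    by (rule continuous_on_compose2[OF Int_Y_plus_continuous[OF assms(2)]])
      (auto intro: continuous_intros)
  ultimately show "Y_state r \<in> C_space" by (simp add: C_space_def Y_state_def)
  show "0 \<le> Y_state r \<theta> x $ i" for \<theta> x i
    using Int_Y_plus_nth_pos[OF assms(2), of \<theta> i] by (simp add: Y_state_def)
qed

lemma tent_C_plus:
  fixes r :: "'m::topological_space \<Rightarrow> real ^ 'n::finite"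
  assumes "compact (UNIV :: 'm set)" and r: "r \<in> Int_Y_plus" and s: "0 \<le> s"
  shows "tent r s y \<in> C_plus"
proof (rule C_plusI)
  obtain R where R: "\<And>\<theta>. norm (r \<theta>) \<le> R" by (rule Int_Y_plus_upper_bound[OF assms(1) r]) (rule that)
  have "norm (tent r s y \<theta> x) \<le> s * R" for \<theta> x
  proof -
    have "s * max 0 (1 - \<bar>x - y\<bar>) * norm (r \<theta>) \<le> s * R"
      using s R[of \<theta>] mult_mono[of "s * max 0 (1 - \<bar>x - y\<bar>)" s "norm (r \<theta>)" R]
      by (simp add: mult_left_le)
    then show ?thesis using s by (simp add: tent_def abs_mult)
  qed
  then have "bounded (range (\<lambda>(\<theta>, x). tent r s y \<theta> x))"
    by (auto simp: bounded_iff intro!: exI[of _ "s * R"])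
  moreover have "continuous_on UNIV (\<lambda>p :: 'm \<times> real. r (fst p))"
    by (rule continuous_on_compose2[OF Int_Y_plus_continuous[OF r]]) (auto intro: continuous_intros)
  then have "continuous_on UNIV (\<lambda>(\<theta>, x). tent r s y \<theta> x)"
    unfolding tent_def case_prod_unfold by (intro continuous_intros)
  ultimately show "tent r s y \<in> C_space" by (simp add: C_space_def)
  show "0 \<le> tent r s y \<theta> x $ i" for \<theta> x i
    using s Int_Y_plus_nth_pos[OF r, of \<theta> i] by (simp add: tent_nth)
qed

lemma tent_le_Y_state:
  assumes r: "r \<in> Int_Y_plus" and s: "0 \<le> s" "s \<le> 1"
  shows "tent r s y \<le> Y_state r"
  unfolding state_le_iff
proof (intro allI)
  fix \<theta> x i
  have "s * max 0 (1 - \<bar>x - y\<bar>) \<le> 1" using s by (intro mult_le_one) auto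
  then show "tent r s y \<theta> x $ i \<le> Y_state r \<theta> x $ i"
    using mult_right_mono[of _ 1 "r \<theta> $ i"] Int_Y_plus_nth_pos[OF r, of \<theta> i]
    by (simp add: tent_nth Y_state_def)
qed

lemma tent_le:
  assumes \<phi>: "\<phi> \<in> C_plus" and r: "r \<in> Int_Y_plus" and s: "0 \<le> s"
    and le: "\<And>\<theta> x i. \<bar>x - y\<bar> < 1 \<Longrightarrow> s * r \<theta> $ i \<le> \<phi> \<theta> x $ i"
  shows "tent r s y \<le> \<phi>"
  unfolding state_le_iff
proof (intro allI)
  fix \<theta> x i
  show "tent r s y \<theta> x $ i \<le> \<phi> \<theta> x $ i"
  proof (cases "\<bar>x - y\<bar> < 1")
    case True
    have "s * max 0 (1 - \<bar>x - y\<bar>) * r \<theta> $ i \<le> s * r \<theta> $ i"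
      using s Int_Y_plus_nth_pos[OF r, of \<theta> i]
      by (intro mult_right_mono mult_left_le) auto
    then show ?thesis using le[OF True, of \<theta> i] by (simp add: tent_nth)
  next
    case False
    then show ?thesis using C_plus_nonneg[OF \<phi>] by (simp add: tent_nth)
  qed
qed

lemma tent_peak: "tent r s y \<theta> y $ i = s * r \<theta> $ i"
  by (simp add: tent_nth)

section \<open>Spreading of tents\<close>

lemma state_minus_profile_bound:
  assumes "\<phi> \<in> C_plus" and "\<And>\<theta>. norm (r \<theta>) \<le> R"
  obtains B where "\<And>\<theta> x. norm (\<phi> \<theta> x - r \<theta>) \<le> B"
proof -
  obtain A where "\<And>\<theta> x. norm (\<phi> \<theta> x) \<le> A"
    using C_space_bound[OF C_plus_C_space[OF assms(1)]] by blast
  then have "norm (\<phi> \<theta> x - r \<theta>) \<le> A + R" for \<theta> x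
    by (meson assms(2) add_mono norm_triangle_ineq4 order_trans)
  then show thesis by (rule that)
qed

text \<open>
  The constants \<open>cm\<close> and \<open>cp\<close> are the leftward and rightward spreading speeds of the limit map, and
  \<open>r\<close> is the positive equilibrium that it approaches.
\<close>

locale spreading_map = rightward_limit_map Q
  for Q :: "('m::topological_space, 'n::finite) state \<Rightarrow> ('m, 'n) state" +
  fixes r :: "'m \<Rightarrow> real ^ 'n" and cm cp :: real
  assumes M_compact: "compact (UNIV :: 'm set)"
    and r: "r \<in> Int_Y_plus"
    and lim_plus_r: "lim_plus Q (Y_state r) = Y_state r"
    and UC: "UC (lim_plus Q) cm cp r"
begin

lemma UC_uniform:
  assumes \<phi>: "\<phi> \<in> C_plus - {C_zero}" and \<epsilon>: "0 < \<epsilon>" "\<epsilon> < (cp + cm) / 2" and \<eta>: "0 < \<eta>"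
  shows "\<forall>\<^sub>F n in sequentially. \<forall>\<theta>. \<forall>x\<in>{real n * (- cm + \<epsilon>)..real n * (cp - \<epsilon>)}.
    norm ((lim_plus Q ^^ n) \<phi> \<theta> x - r \<theta>) < \<eta>"
proof -
  let ?I = "\<lambda>n. {real n * (- cm + \<epsilon>)..real n * (cp - \<epsilon>)}"
  let ?f = "\<lambda>n x. Y_norm (\<lambda>\<theta>. (lim_plus Q ^^ n) \<phi> \<theta> x - r \<theta>)"
  have "(\<lambda>n. max0 (?I n) (?f n)) \<longlonglongrightarrow> 0"
    using UC \<phi> \<epsilon> unfolding UC_def by auto
  then have "\<forall>\<^sub>F n in sequentially. max0 (?I n) (?f n) < \<eta>"
    using \<eta> by (rule order_tendstoD)
  then show ?thesis
  proof (eventually_elim, intro allI ballI)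
    fix n \<theta> x assume n: "max0 (?I n) (?f n) < \<eta>" and x: "x \<in> ?I n"
    obtain R where R: "\<And>\<theta>. norm (r \<theta>) \<le> R" by (rule Int_Y_plus_upper_bound[OF M_compact r]) (rule that)
    have \<phi>n: "(lim_plus Q ^^ n) \<phi> \<in> C_plus" using \<phi> by (intro lim_plus_funpow_C_plus) simp
    obtain B where B: "\<And>\<theta> x. norm ((lim_plus Q ^^ n) \<phi> \<theta> x - r \<theta>) \<le> B"
      by (rule state_minus_profile_bound[OF \<phi>n R]) (rule that)
    have "norm ((lim_plus Q ^^ n) \<phi> \<theta> x - r \<theta>) \<le> ?f n x"
      unfolding Y_norm_def by (rule cSUP_upper) (use B in \<open>auto intro!: bdd_aboveI2\<close>)
    also have "\<dots> \<le> (SUP x\<in>?I n. ?f n x)"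
    proof (rule cSUP_upper[OF x], rule bdd_aboveI2)
      show "?f n x \<le> B" for x unfolding Y_norm_def by (rule cSUP_least) (use B in auto)
    qed
    also have "\<dots> = max0 (?I n) (?f n)" using x unfolding max0_def by auto
    finally show "norm ((lim_plus Q ^^ n) \<phi> \<theta> x - r \<theta>) < \<eta>" using n by linarith
  qed
qed

lemma tent_not_zero: "0 < s \<Longrightarrow> tent r s y \<in> C_plus - {C_zero}"
proof
  assume s: "0 < s"
  then show "tent r s y \<in> C_plus" by (intro tent_C_plus M_compact r) simp
  have "tent r s y undefined y $ undefined \<noteq> C_zero undefined y $ undefined"
    using s Int_Y_plus_nth_pos[OF r, of undefined undefined] by (simp add: tent_peak C_zero_def)
  then show "tent r s y \<notin> {C_zero}" by auto
qed

text \<open>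
  For the limit map this is \<open>(UC)\<close> on the window with \<open>\<epsilon>/2\<close>: its margin \<open>k \<epsilon>/2\<close> over the window with
  \<open>\<epsilon>\<close> contains the support of a tent once \<open>k \<ge> 2/\<epsilon>\<close>. For fixed \<open>k\<close> the window is bounded, so
  \<open>Q ^^ k\<close> inherits the estimate far enough to the right. The threshold \<open>y\<^sub>0\<close> depends on \<open>k\<close> and on the
  initial height \<open>s\<close>.
\<close>

lemma tent_spreads:
  assumes s: "0 < s" and t: "0 \<le> t" "t < 1" and \<epsilon>: "0 < \<epsilon>" "\<epsilon> < (cp + cm) / 2"
  shows "\<forall>\<^sub>F k in sequentially. \<exists>y\<^sub>0. \<forall>y\<ge>y\<^sub>0. \<forall>v\<in>{- cm + \<epsilon>..cp - \<epsilon>}.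
    tent r t (y + real k * v) \<le> (Q ^^ k) (tent r s y)"
proof -
  obtain c where c: "0 < c" "\<And>\<theta> i. c \<le> r \<theta> $ i"
    by (rule Int_Y_plus_lower_bound[OF M_compact r]) (rule that)
  \<comment> \<open>The gap between \<open>t r\<close> and \<open>r\<close> is split between the two approximations, by \<open>(UC)\<close> and by \<open>Q\<^sub>+\<close>.\<close>
  define \<eta> where "\<eta> = (1 - t) * c / 2"
  have \<eta>: "0 < \<eta>" using t c by (simp add: \<eta>_def)
  have \<eta>_le: "t * r \<theta> $ i \<le> r \<theta> $ i - 2 * \<eta>" for \<theta> i
  proof -
    have "(1 - t) * c \<le> (1 - t) * r \<theta> $ i" using c(2)[of \<theta> i] t by (intro mult_left_mono) auto
    moreover have "2 * \<eta> = (1 - t) * c" by (simp add: \<eta>_def)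
    ultimately show ?thesis by (simp add: algebra_simps)
  qed
  have "\<forall>\<^sub>F k in sequentially. \<forall>\<theta>. \<forall>x\<in>{real k * (- cm + \<epsilon>/2)..real k * (cp - \<epsilon>/2)}.
      norm ((lim_plus Q ^^ k) (tent r s 0) \<theta> x - r \<theta>) < \<eta>"
    using \<epsilon> by (intro UC_uniform tent_not_zero s \<eta>) auto
  moreover have "\<forall>\<^sub>F k in sequentially. 2 / \<epsilon> \<le> real k"
    by (meson eventually_sequentiallyI nat_ceiling_le_eq)
  ultimately show ?thesis
  proof eventually_elim
    fix k :: nat
    assume near: "\<forall>\<theta>. \<forall>x\<in>{real k * (- cm + \<epsilon>/2)..real k * (cp - \<epsilon>/2)}.
        norm ((lim_plus Q ^^ k) (tent r s 0) \<theta> x - r \<theta>) < \<eta>"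
      and "2 / \<epsilon> \<le> real k"
    then have k: "1 \<le> real k * (\<epsilon>/2)" using \<epsilon> by (simp add: field_simps)
    let ?a = "real k * (- cm + \<epsilon>/2)" and ?b = "real k * (cp - \<epsilon>/2)"
    have tent0: "tent r s 0 \<in> C_plus" using tent_not_zero[OF s] by blast
    obtain y\<^sub>0 where y\<^sub>0: "\<And>y \<theta> x. y\<^sub>0 \<le> y \<Longrightarrow> \<bar>x - y\<bar> \<le> \<bar>?a\<bar> + \<bar>?b\<bar> \<Longrightarrow>
        norm ((Q ^^ k) (shift y (tent r s 0)) \<theta> x - (lim_plus Q ^^ k) (tent r s 0) \<theta> (x - y)) < \<eta>"
      using Q_funpow_far_right[OF tent0 \<eta>] by blast
    show "\<exists>y\<^sub>0. \<forall>y\<ge>y\<^sub>0. \<forall>v\<in>{- cm + \<epsilon>..cp - \<epsilon>}.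
        tent r t (y + real k * v) \<le> (Q ^^ k) (tent r s y)"
    proof (intro exI allI impI ballI)
      fix y v assume y: "y\<^sub>0 \<le> y" and v: "v \<in> {- cm + \<epsilon>..cp - \<epsilon>}"
      show "tent r t (y + real k * v) \<le> (Q ^^ k) (tent r s y)"
      proof (rule tent_le[OF Q_funpow_C_plus r t(1)])
        show "tent r s y \<in> C_plus" using tent_not_zero[OF s] by blast
        fix \<theta> x i assume x: "\<bar>x - (y + real k * v)\<bar> < 1"
        have "real k * (- cm + \<epsilon>) \<le> real k * v" "real k * v \<le> real k * (cp - \<epsilon>)"
          using v by (auto intro: mult_left_mono)
        then have w: "?a \<le> x - y" "x - y \<le> ?b"
          using x k by (auto simp: algebra_simps abs_if split: if_splits)
        have "norm ((Q ^^ k) (tent r s y) \<theta> x - (lim_plus Q ^^ k) (tent r s 0) \<theta> (x - y)) < \<eta>"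
        proof -
          have "\<bar>u\<bar> \<le> \<bar>a\<bar> + \<bar>b\<bar>" if "a \<le> u" "u \<le> b" for a b u :: real
            using that by linarith
          from y\<^sub>0[OF y this[OF w], of \<theta>] show ?thesis by (simp add: shift_tent)
        qed
        then have "\<bar>(Q ^^ k) (tent r s y) \<theta> x $ i
            - (lim_plus Q ^^ k) (tent r s 0) \<theta> (x - y) $ i\<bar> < \<eta>"
          using component_le_norm_cart[of "(Q ^^ k) (tent r s y) \<theta> x
            - (lim_plus Q ^^ k) (tent r s 0) \<theta> (x - y)" i] by simp
        moreover have "norm ((lim_plus Q ^^ k) (tent r s 0) \<theta> (x - y) - r \<theta>) < \<eta>"
          using near w by simp
        then have "\<bar>(lim_plus Q ^^ k) (tent r s 0) \<theta> (x - y) $ i - r \<theta> $ i\<bar> < \<eta>"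
          using component_le_norm_cart[of "(lim_plus Q ^^ k) (tent r s 0) \<theta> (x - y) - r \<theta>" i]
          by simp
        ultimately show "t * r \<theta> $ i \<le> (Q ^^ k) (tent r s y) \<theta> x $ i"
          using \<eta>_le[of \<theta> i] by linarith
      qed
    qed
  qed
qed

text \<open>
  A tent that reproduces itself at a displaced position can be iterated. The step lengths in
  \<open>{n\<^sub>0..<2 * n\<^sub>0}\<close> need finitely many thresholds, and every larger \<open>n\<close> is a sum of such steps. A
  velocity \<open>v \<ge> 0\<close> keeps all intermediate tents to the right of the common threshold, so \<open>y\<^sub>0\<close> does
  not depend on \<open>n\<close>.
\<close>

lemma tent_travels:
  assumes s: "0 < s" "s < 1" and \<epsilon>: "0 < \<epsilon>" "\<epsilon> < (cp + cm) / 2"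
  obtains n\<^sub>0 y\<^sub>0 where "\<And>n y v. n\<^sub>0 \<le> n \<Longrightarrow> y\<^sub>0 \<le> y \<Longrightarrow> 0 \<le> v \<Longrightarrow> - cm + \<epsilon> \<le> v \<Longrightarrow> v \<le> cp - \<epsilon> \<Longrightarrow>
    tent r s (y + real n * v) \<le> (Q ^^ n) (tent r s y)"
proof -
  have tent: "tent r s y \<in> C_plus" for y using tent_not_zero[OF s(1)] by blast
  have "\<forall>\<^sub>F k in sequentially. 0 < k \<and> (\<exists>y\<^sub>0. \<forall>y\<ge>y\<^sub>0. \<forall>v\<in>{- cm + \<epsilon>..cp - \<epsilon>}.
      tent r s (y + real k * v) \<le> (Q ^^ k) (tent r s y))"
    using tent_spreads[OF s(1) _ s(2) \<epsilon>] s(1)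
    by (intro eventually_conj eventually_gt_at_top) auto
  then obtain n\<^sub>0 where n\<^sub>0: "\<And>k. n\<^sub>0 \<le> k \<Longrightarrow> 0 < k \<and> (\<exists>y\<^sub>0. \<forall>y\<ge>y\<^sub>0. \<forall>v\<in>{- cm + \<epsilon>..cp - \<epsilon>}.
      tent r s (y + real k * v) \<le> (Q ^^ k) (tent r s y))"
    unfolding eventually_sequentially by blast
  then have "0 < n\<^sub>0" by blast
  from n\<^sub>0 obtain Y where Y: "\<And>k y v. n\<^sub>0 \<le> k \<Longrightarrow> Y k \<le> y \<Longrightarrow> v \<in> {- cm + \<epsilon>..cp - \<epsilon>} \<Longrightarrow>
      tent r s (y + real k * v) \<le> (Q ^^ k) (tent r s y)"
    by metis
  define y\<^sub>0 where "y\<^sub>0 = Max (Y ` {n\<^sub>0..<2 * n\<^sub>0})"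
  have Y_le: "Y k \<le> y\<^sub>0" if "n\<^sub>0 \<le> k" "k < 2 * n\<^sub>0" for k
    unfolding y\<^sub>0_def using that by (intro Max_ge) auto
  show thesis
  proof (rule that)
    fix n y v
    assume "n\<^sub>0 \<le> n" "y\<^sub>0 \<le> y" and v: "0 \<le> v" "- cm + \<epsilon> \<le> v" "v \<le> cp - \<epsilon>"
    then show "tent r s (y + real n * v) \<le> (Q ^^ n) (tent r s y)"
    proof (induction n rule: less_induct)
      case (less n)
      show ?case
      proof (cases "n < 2 * n\<^sub>0")
        case True
        then show ?thesis using Y Y_le[of n] less.prems by auto
      next
        case False
        define k where "k = n - n\<^sub>0"
        have k: "k < n" "n\<^sub>0 \<le> k" "n = n\<^sub>0 + k" using False \<open>0 < n\<^sub>0\<close> by (auto simp: k_def)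
        have "Y n\<^sub>0 \<le> y\<^sub>0" using \<open>0 < n\<^sub>0\<close> by (intro Y_le) auto
        moreover have "0 \<le> real k * v" using v by simp
        ultimately have "Y n\<^sub>0 \<le> y + real k * v" using less.prems by linarith
        then have "tent r s (y + real k * v + real n\<^sub>0 * v) \<le> (Q ^^ n\<^sub>0) (tent r s (y + real k * v))"
          using v by (intro Y) auto
        also have "\<dots> \<le> (Q ^^ n\<^sub>0) ((Q ^^ k) (tent r s y))"
          using less.IH[OF k(1,2)] less.prems by (intro Q_funpow_mono Q_funpow_C_plus tent) auto
        finally show ?thesis unfolding k(3) funpow_add by (simp add: algebra_simps)
      qed
    qed
  qed
qed

text \<open>
  Suppose that the orbit of \<open>\<phi>\<close> dominates tents of one fixed height \<open>\<kappa>\<close> arbitrarily far to the right.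
  The height has to be fixed before the position, since the distance from which \<open>k\<close> steps lift a tent
  from \<open>\<kappa>\<close> to \<open>s\<close> depends on \<open>\<kappa>\<close>. Once lifted, the tent travels with every admissible velocity
  and its centre sweeps a window that grows linearly. Travelling with the margin \<open>\<epsilon>/2\<close> instead of \<open>\<epsilon>\<close>
  absorbs the fixed delay \<open>p\<close> and the fixed starting point \<open>z\<close>.
\<close>

lemma spreading_of_persistent:
  assumes \<phi>: "\<phi> \<in> C_plus" and \<kappa>: "0 < \<kappa>"
    and persistent: "\<And>Y. \<exists>m y. Y \<le> y \<and> tent r \<kappa> y \<le> (Q ^^ m) \<phi>"
    and s: "0 < s" "s < 1" and \<epsilon>: "0 < \<epsilon>" "\<epsilon> < (cp + cm) / 2"
  shows "\<forall>\<^sub>F n in sequentially. \<forall>\<theta> x i.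
    real n * max \<epsilon> (- cm + \<epsilon>) \<le> x \<and> x \<le> real n * (cp - \<epsilon>) \<longrightarrow> s * r \<theta> $ i \<le> (Q ^^ n) \<phi> \<theta> x $ i"
proof (cases "max \<epsilon> (- cm + \<epsilon>) \<le> cp - \<epsilon>")
  case False
  \<comment> \<open>The window is empty for every positive \<open>n\<close>.\<close>
  have "\<forall>\<^sub>F n :: nat in sequentially. 0 < n" by (rule eventually_gt_at_top)
  then show ?thesis
  proof (eventually_elim, intro allI impI)
    fix n :: nat and \<theta> x i
    assume "0 < n" "real n * max \<epsilon> (- cm + \<epsilon>) \<le> x \<and> x \<le> real n * (cp - \<epsilon>)"
    then have "real n * max \<epsilon> (- cm + \<epsilon>) \<le> real n * (cp - \<epsilon>)" "0 < real n"
      by (blast intro: order_trans, simp)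
    then have "max \<epsilon> (- cm + \<epsilon>) \<le> cp - \<epsilon>" by (simp only: mult_le_cancel_left_pos)
    with False show "s * r \<theta> $ i \<le> (Q ^^ n) \<phi> \<theta> x $ i" by blast
  qed
next
  case True
  let ?a = "max \<epsilon> (- cm + \<epsilon>)" and ?b = "cp - \<epsilon>"
  have tent: "tent r t y \<in> C_plus" if "0 < t" for t y using tent_not_zero[OF that] by blast
  obtain n\<^sub>0 y\<^sub>0 where travel: "\<And>n y v. n\<^sub>0 \<le> n \<Longrightarrow> y\<^sub>0 \<le> y \<Longrightarrow> 0 \<le> v \<Longrightarrow> - cm + \<epsilon>/2 \<le> v \<Longrightarrow>
      v \<le> cp - \<epsilon>/2 \<Longrightarrow> tent r s (y + real n * v) \<le> (Q ^^ n) (tent r s y)"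
    using tent_travels[OF s, of "\<epsilon>/2"] \<epsilon> by auto
  obtain k y\<^sub>1 where grow: "\<And>y. y\<^sub>1 \<le> y \<Longrightarrow> tent r s (y + real k * ?a) \<le> (Q ^^ k) (tent r \<kappa> y)"
  proof -
    have "\<forall>\<^sub>F k in sequentially. \<exists>y\<^sub>1. \<forall>y\<ge>y\<^sub>1. \<forall>v\<in>{- cm + \<epsilon>..cp - \<epsilon>}.
        tent r s (y + real k * v) \<le> (Q ^^ k) (tent r \<kappa> y)"
      using s \<epsilon> by (intro tent_spreads \<kappa>) auto
    then obtain k y\<^sub>1 where "\<forall>y\<ge>y\<^sub>1. \<forall>v\<in>{- cm + \<epsilon>..cp - \<epsilon>}.
        tent r s (y + real k * v) \<le> (Q ^^ k) (tent r \<kappa> y)"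
      using eventually_happens'[OF sequentially_bot] by blast
    moreover have "?a \<in> {- cm + \<epsilon>..cp - \<epsilon>}" using True by auto
    ultimately show thesis using that by blast
  qed
  obtain m y where y: "max y\<^sub>0 y\<^sub>1 \<le> y" and m: "tent r \<kappa> y \<le> (Q ^^ m) \<phi>"
    using persistent by blast
  define z where "z = y + real k * ?a"
  define p where "p = k + m"
  have "0 \<le> real k * ?a" using \<epsilon> by simp
  then have z: "y\<^sub>0 \<le> z" using y by (simp add: z_def)
  have "tent r s z \<le> (Q ^^ k) (tent r \<kappa> y)" using grow y by (simp add: z_def)
  also have "\<dots> \<le> (Q ^^ k) ((Q ^^ m) \<phi>)" using \<kappa> by (intro Q_funpow_mono Q_funpow_C_plus \<phi> m tent)
  finally have p: "tent r s z \<le> (Q ^^ p) \<phi>" by (simp add: p_def funpow_add)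
  \<comment> \<open>For \<open>n \<ge> N\<close> the gain \<open>n \<epsilon>/2\<close> exceeds the error due to \<open>z\<close> and to the \<open>p\<close> initial steps.\<close>
  define N where "N = max (max 1 n\<^sub>0) (nat \<lceil>2 * (\<bar>z\<bar> + real p * \<bar>?b\<bar>) / \<epsilon>\<rceil>)"
  have "\<forall>\<^sub>F n in sequentially. N + p \<le> n" by (rule eventually_ge_at_top)
  then show ?thesis
  proof (eventually_elim, intro allI impI)
    fix n' :: nat and \<theta> x i
    assume "N + p \<le> n'" and x: "real n' * ?a \<le> x \<and> x \<le> real n' * ?b"
    define n where "n = n' - p"
    have "N \<le> n" and n': "n' = n + p" using \<open>N + p \<le> n'\<close> by (simp_all add: n_def)
    then have n: "n' = n + p" "n\<^sub>0 \<le> n" "0 < n" by (simp_all add: N_def)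
    have "nat \<lceil>2 * (\<bar>z\<bar> + real p * \<bar>?b\<bar>) / \<epsilon>\<rceil> \<le> n"
      using \<open>N \<le> n\<close> by (simp add: N_def)
    then have "2 * (\<bar>z\<bar> + real p * \<bar>?b\<bar>) / \<epsilon> \<le> real n" by (simp only: nat_ceiling_le_eq)
    then have n_big: "\<bar>z\<bar> + real p * \<bar>?b\<bar> \<le> real n * (\<epsilon>/2)" using \<epsilon> by (simp add: field_simps)
    \<comment> \<open>The constant velocity that carries the tent from \<open>z\<close> to \<open>x\<close> in \<open>n\<close> steps.\<close>
    define v where "v = (x - z) / real n"
    have nv: "real n * v = x - z" using n(3) by (simp add: v_def)
    have pa: "0 \<le> real p * ?a" using \<epsilon> by simp
    have pb0: "0 \<le> real p * \<bar>?b\<bar>" by simp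
    have pb: "real p * ?b \<le> real p * \<bar>?b\<bar>" by (intro mult_left_mono) auto
    have "real n * ?a + real p * ?a \<le> x" using x by (simp add: n(1) algebra_simps)
    then have "real n * (?a - \<epsilon>/2) \<le> real n * v"
      using n_big pa pb0 abs_ge_self[of z] unfolding nv right_diff_distrib by linarith
    then have va: "?a - \<epsilon>/2 \<le> v" using n(3) by simp
    have "x \<le> real n * ?b + real p * ?b" using x by (simp add: n(1) algebra_simps)
    then have "real n * v \<le> real n * (?b + \<epsilon>/2)"
      using n_big pb abs_ge_minus_self[of z] unfolding nv distrib_left by linarith
    then have vb: "v \<le> ?b + \<epsilon>/2" using n(3) by simp
    have "tent r s (z + real n * v) \<le> (Q ^^ n) (tent r s z)"
      using va vb \<epsilon> by (intro travel n z) auto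
    also have "\<dots> \<le> (Q ^^ n) ((Q ^^ p) \<phi>)"
      using s by (intro Q_funpow_mono Q_funpow_C_plus \<phi> p tent)
    finally have "tent r s x \<le> (Q ^^ n') \<phi>" by (simp add: n(1) funpow_add nv)
    then show "s * r \<theta> $ i \<le> (Q ^^ n') \<phi> \<theta> x $ i"
      unfolding state_le_iff by (metis tent_peak)
  qed
qed

section \<open>Persistence far to the right\<close>

text \<open>
  On \<open>[0, r]\<close> the chain \<open>Q \<psi> \<le> Q r \<le> Q\<^sub>+ r = r\<close> applies.
\<close>

lemma C_below_r_invariant:
  assumes "\<phi> \<in> C_below (Y_state r)"
  shows "(Q ^^ n) \<phi> \<in> C_below (Y_state r)"
proof (induction n)
  case (Suc n)
  then have \<psi>: "(Q ^^ n) \<phi> \<in> C_plus" "(Q ^^ n) \<phi> \<le> Y_state r" by (simp_all add: C_below_iff)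
  have "Q ((Q ^^ n) \<phi>) \<le> Q (Y_state r)" by (intro Q_mono \<psi> Y_state_C_plus M_compact r)
  also have "\<dots> \<le> lim_plus Q (Y_state r)" by (intro Q_le_lim_plus Y_state_C_plus M_compact r)
  finally show ?case using \<psi> by (simp add: C_below_iff Q_C_plus lim_plus_r)
qed (use assms in simp)

lemma subhomogeneous_funpow:
  assumes subhom: "subhomogeneous_on (C_below (Y_state r)) Q" and \<kappa>: "0 \<le> \<kappa>" "\<kappa> \<le> 1"
    and \<phi>: "\<phi> \<in> C_below (Y_state r)"
  shows "(\<lambda>\<theta> x. \<kappa> *\<^sub>R (Q ^^ n) \<phi> \<theta> x) \<le> (Q ^^ n) (\<lambda>\<theta> x. \<kappa> *\<^sub>R \<phi> \<theta> x)"
proof (induction n)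
  case (Suc n)
  have \<phi>': "\<phi> \<in> C_plus" using \<phi> by (simp add: C_below_iff)
  have "(\<lambda>\<theta> x. \<kappa> *\<^sub>R Q ((Q ^^ n) \<phi>) \<theta> x) \<le> Q (\<lambda>\<theta> x. \<kappa> *\<^sub>R (Q ^^ n) \<phi> \<theta> x)"
    using subhom \<kappa> C_below_r_invariant[OF \<phi>] by (simp add: subhomogeneous_on_def)
  also have "\<dots> \<le> Q ((Q ^^ n) (\<lambda>\<theta> x. \<kappa> *\<^sub>R \<phi> \<theta> x))"
    by (intro Q_mono Suc.IH scale_C_plus Q_funpow_C_plus \<phi>' \<kappa>)
  finally show ?case by simp
qed simp

text \<open>
  Strong positivity puts a tent, possibly very low, under the orbit at the position where the tent of
  height \<open>1/2\<close> starts to travel. Subhomogeneity multiplies the inequality for that tent by an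
  arbitrarily small \<open>\<kappa>\<close> while keeping its threshold, so the low tent travels to the right without
  losing height. The velocity is chosen strictly between \<open>max 0 (- cm)\<close> and \<open>cp\<close>; its positivity is
  what makes the positions unbounded.
\<close>

lemma persistent_of_subhomogeneous:
  assumes subhom: "subhomogeneous_on (C_below (Y_state r)) Q" and SP: "SP Q" and cp: "0 < cp"
    and \<phi>: "\<phi> \<in> C_plus - {C_zero}"
  obtains \<kappa> where "0 < \<kappa>" "\<And>Y. \<exists>m y. Y \<le> y \<and> tent r \<kappa> y \<le> (Q ^^ m) \<phi>"
proof -
  define v where "v = (max 0 (- cm) + cp) / 2"
  define \<epsilon> where "\<epsilon> = min (v + cm) (cp - v) / 2"
  have cmcp: "0 < cp + cm" using UC by (simp add: UC_def)
  have v: "0 < v" "- cm < v" "v < cp" using cp cmcp by (auto simp: v_def)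
  have \<epsilon>: "0 < \<epsilon>" "\<epsilon> < (cp + cm) / 2" "- cm + \<epsilon> \<le> v" "v \<le> cp - \<epsilon>"
    using v by (auto simp: \<epsilon>_def min_def field_simps split: if_splits)
  have half_bounds: "0 < (1/2 :: real)" "1/2 < (1 :: real)" by simp_all
  obtain n\<^sub>0 y\<^sub>0 where "\<And>n y v. n\<^sub>0 \<le> n \<Longrightarrow> y\<^sub>0 \<le> y \<Longrightarrow> 0 \<le> v \<Longrightarrow> - cm + \<epsilon> \<le> v \<Longrightarrow>
      v \<le> cp - \<epsilon> \<Longrightarrow> tent r (1/2) (y + real n * v) \<le> (Q ^^ n) (tent r (1/2) y)"
    by (rule tent_travels[OF half_bounds \<epsilon>(1,2)]) (rule that)
  then have travel: "tent r (1/2) (y + real n * v) \<le> (Q ^^ n) (tent r (1/2) y)"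
    if "n\<^sub>0 \<le> n" "y\<^sub>0 \<le> y" for n y
    using that \<epsilon>(3,4) less_imp_le[OF v(1)] by blast
  \<comment> \<open>With \<open>y \<ge> 2\<close> the support of the tent lies in the half line where strong positivity applies.\<close>
  define y where "y = max y\<^sub>0 2"
  obtain N where N: "\<And>\<theta> x. 0 < x \<Longrightarrow> (Q ^^ N) \<phi> \<theta> x \<in> Int_pos"
    using SP \<phi> unfolding SP_def by blast
  have QN: "(Q ^^ N) \<phi> \<in> C_plus" using \<phi> by (intro Q_funpow_C_plus) auto
  obtain c where c: "0 < c" "\<And>\<theta> x i. x \<in> {y - 1..y + 1} \<Longrightarrow> c \<le> (Q ^^ N) \<phi> \<theta> x $ i"
  proof -
    have 1: "compact ((UNIV :: 'm set) \<times> {y - 1..y + 1})"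
      by (intro compact_Times M_compact compact_Icc)
    have 2: "continuous_on (UNIV \<times> {y - 1..y + 1}) (\<lambda>(\<theta>, x). (Q ^^ N) \<phi> \<theta> x)"
      using C_plus_C_space[OF QN] unfolding C_space_def by (blast intro: continuous_on_subset)
    have 3: "(case p of (\<theta>, x) \<Rightarrow> (Q ^^ N) \<phi> \<theta> x) \<in> Int_pos"
      if "p \<in> UNIV \<times> {y - 1..y + 1}" for p
    proof -
      obtain \<theta> x where p: "p = (\<theta>, x)" by fastforce
      moreover have "2 \<le> y" by (simp add: y_def)
      ultimately have "0 < x" using that by simp
      then show ?thesis using N[of x \<theta>] p by simp
    qed
    obtain c where "0 < c" and c: "\<And>p i. p \<in> UNIV \<times> {y - 1..y + 1} \<Longrightarrow>
        c \<le> (case p of (\<theta>, x) \<Rightarrow> (Q ^^ N) \<phi> \<theta> x) $ i"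
      by (rule compact_Int_pos_lower_bound[OF 1 2], erule 3, rule that)
    show thesis by (rule that[OF \<open>0 < c\<close>]) (use c[of "(_, _)"] in simp)
  qed
  obtain R where R: "\<And>\<theta>. norm (r \<theta>) \<le> R" by (rule Int_Y_plus_upper_bound[OF M_compact r]) (rule that)
  have "0 \<le> R" using R[of undefined] norm_ge_zero order_trans by blast
  define \<kappa> where "\<kappa> = min 1 (c / (R + 1))"
  have \<kappa>: "0 < \<kappa>" "\<kappa> \<le> 1" using c(1) \<open>0 \<le> R\<close> by (auto simp: \<kappa>_def)
  have \<kappa>_le: "\<kappa> * r \<theta> $ i \<le> c" for \<theta> i
  proof -
    have "r \<theta> $ i \<le> R + 1" using R[of \<theta>] component_le_norm_cart[of "r \<theta>" i] by linarith
    then have "\<kappa> * r \<theta> $ i \<le> c / (R + 1) * (R + 1)"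
      using c(1) \<open>0 \<le> R\<close> Int_Y_plus_nth_pos[OF r, of \<theta> i] by (intro mult_mono) (auto simp: \<kappa>_def)
    then show ?thesis using \<open>0 \<le> R\<close> by simp
  qed
  have half: "tent r (1/2) y \<in> C_below (Y_state r)" for y
    by (simp add: C_below_iff tent_C_plus M_compact r tent_le_Y_state)
  have start: "tent r (\<kappa> * (1/2)) y \<le> (Q ^^ N) \<phi>"
  proof (rule tent_le[OF QN r])
    fix \<theta> x i assume "\<bar>x - y\<bar> < 1"
    then have "c \<le> (Q ^^ N) \<phi> \<theta> x $ i" by (intro c(2)) (auto simp: abs_if split: if_splits)
    moreover have "\<kappa> * (1/2) * r \<theta> $ i \<le> \<kappa> * r \<theta> $ i"
      using \<kappa>(1) Int_Y_plus_nth_pos[OF r, of \<theta> i] by simp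
    ultimately show "\<kappa> * (1/2) * r \<theta> $ i \<le> (Q ^^ N) \<phi> \<theta> x $ i" using \<kappa>_le[of \<theta> i] by linarith
  qed (use \<kappa> in simp)
  show thesis
  proof (rule that)
    show "0 < \<kappa> * (1/2)" using \<kappa> by simp
    fix Y
    define n where "n = max n\<^sub>0 (nat \<lceil>(\<bar>Y\<bar> + \<bar>y\<bar>) / v\<rceil>)"
    have n: "n\<^sub>0 \<le> n" "nat \<lceil>(\<bar>Y\<bar> + \<bar>y\<bar>) / v\<rceil> \<le> n" by (simp_all add: n_def)
    then have "(\<bar>Y\<bar> + \<bar>y\<bar>) / v \<le> real n" by (simp only: nat_ceiling_le_eq)
    then have "\<bar>Y\<bar> + \<bar>y\<bar> \<le> real n * v" using v(1) by (simp add: field_simps)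
    then have Y: "Y \<le> y + real n * v" by linarith
    have "y\<^sub>0 \<le> y" by (simp add: y_def)
    from travel[OF n(1) this]
    have "tent r (1/2) (y + real n * v) \<theta> x $ i \<le> (Q ^^ n) (tent r (1/2) y) \<theta> x $ i" for \<theta> x i
      unfolding state_le_iff by blast
    note travel_nth = mult_left_mono[OF this less_imp_le[OF \<kappa>(1)]]
    have "tent r (\<kappa> * (1/2)) (y + real n * v)
        = (\<lambda>\<theta> x. \<kappa> *\<^sub>R tent r (1/2) (y + real n * v) \<theta> x)"
      by (simp only: scale_tent)
    also have "\<dots> \<le> (\<lambda>\<theta> x. \<kappa> *\<^sub>R (Q ^^ n) (tent r (1/2) y) \<theta> x)"
      unfolding state_le_iff using travel_nth by simp
    also have "\<dots> \<le> (Q ^^ n) (\<lambda>\<theta> x. \<kappa> *\<^sub>R tent r (1/2) y \<theta> x)"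
      using \<kappa> by (intro subhomogeneous_funpow subhom half) auto
    also have "\<dots> = (Q ^^ n) (tent r (\<kappa> * (1/2)) y)" by (simp only: scale_tent)
    also have "\<dots> \<le> (Q ^^ n) ((Q ^^ N) \<phi>)"
      using \<kappa> by (intro Q_funpow_mono tent_C_plus M_compact r QN start) simp
    finally have "tent r (\<kappa> * (1/2)) (y + real n * v) \<le> (Q ^^ (n + N)) \<phi>" by (simp add: funpow_add)
    with Y show "\<exists>m y. Y \<le> y \<and> tent r (\<kappa> * (1/2)) y \<le> (Q ^^ m) \<phi>" by blast
  qed
qed

text \<open>
  Persistence is inherited from a map \<open>L\<close> below \<open>Q\<close>. The comparison holds on \<open>[0, r]\<close> only, hence the
  initial state is first scaled into this interval, which is invariant under \<open>Q\<close> and therefore contains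
  the smaller orbit of \<open>L\<close>. Since \<open>r\<close> is at most a constant multiple of the equilibrium \<open>\<rho>\<close> of \<open>L\<close>, tents
  built on \<open>\<rho>\<close> dominate lower tents built on \<open>r\<close>.
\<close>

lemma persistent_of_minorant:
  assumes L: "spreading_map L \<rho> dm dp" and subhom: "subhomogeneous_on (C_below (Y_state \<rho>)) L"
    and SP: "SP L" and dp: "0 < dp"
    and le: "\<And>\<psi>. \<psi> \<in> C_below (Y_state r) \<Longrightarrow> L \<psi> \<le> Q \<psi>"
    and \<phi>: "\<phi> \<in> C_plus - {C_zero}"
  obtains \<kappa> where "0 < \<kappa>" "\<And>Y. \<exists>m y. Y \<le> y \<and> tent r \<kappa> y \<le> (Q ^^ m) \<phi>"
proof -
  interpret L: spreading_map L \<rho> dm dp by (rule L)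
  have \<phi>': "\<phi> \<in> C_plus" using \<phi> by simp
  obtain c where c: "0 < c" "\<And>\<theta> i. c \<le> r \<theta> $ i"
    by (rule Int_Y_plus_lower_bound[OF M_compact r]) (rule that)
  obtain d where d: "0 < d" "\<And>\<theta> i. d \<le> \<rho> \<theta> $ i"
    by (rule Int_Y_plus_lower_bound[OF M_compact L.r]) (rule that)
  obtain R where R: "\<And>\<theta>. norm (r \<theta>) \<le> R"
    by (rule Int_Y_plus_upper_bound[OF M_compact r]) (rule that)
  obtain B where B: "\<And>\<theta> x. norm (\<phi> \<theta> x) \<le> B"
    by (rule C_space_bound[OF C_plus_C_space[OF \<phi>']]) (rule that)
  have "0 \<le> R" using R[of undefined] norm_ge_zero order_trans by blast
  have "0 \<le> B" using B[of undefined undefined] norm_ge_zero order_trans by blast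
  define t where "t = min 1 (c / (B + 1))"
  have t: "0 < t" "t \<le> 1" using c(1) \<open>0 \<le> B\<close> by (auto simp: t_def)
  define \<psi> where "\<psi> = (\<lambda>\<theta> x. t *\<^sub>R \<phi> \<theta> x)"
  have \<psi>: "\<psi> \<in> C_plus" unfolding \<psi>_def using t by (intro scale_C_plus \<phi>') simp
  have "\<psi> \<noteq> C_zero"
  proof
    assume "\<psi> = C_zero"
    then have "\<phi> = C_zero" using t(1) by (simp add: \<psi>_def C_zero_def fun_eq_iff)
    then show False using \<phi> by simp
  qed
  have "t * \<phi> \<theta> x $ i \<le> \<phi> \<theta> x $ i" for \<theta> x i
    using mult_right_mono[OF t(2) C_plus_nonneg[OF \<phi>', of \<theta> x i]] by simp
  then have \<psi>_le: "\<psi> \<le> \<phi>" by (simp add: state_le_iff \<psi>_def)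
  have "t * \<phi> \<theta> x $ i \<le> r \<theta> $ i" for \<theta> x i
  proof -
    have "\<phi> \<theta> x $ i \<le> B + 1"
      using B[of \<theta> x] component_le_norm_cart[of "\<phi> \<theta> x" i] by linarith
    then have "t * \<phi> \<theta> x $ i \<le> c / (B + 1) * (B + 1)"
      using c(1) \<open>0 \<le> B\<close> C_plus_nonneg[OF \<phi>'] by (intro mult_mono) (auto simp: t_def)
    then show ?thesis using c(2)[of \<theta> i] \<open>0 \<le> B\<close> by simp
  qed
  then have \<psi>_below: "\<psi> \<in> C_below (Y_state r)"
    unfolding C_below_iff using \<psi> by (simp add: state_le_iff \<psi>_def Y_state_def)
  have L_le: "(L ^^ n) \<psi> \<le> (Q ^^ n) \<psi>" for n
  proof (induction n)
    case (Suc n)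
    have Ln: "(L ^^ n) \<psi> \<in> C_plus" by (rule L.Q_funpow_C_plus[OF \<psi>])
    have "(L ^^ n) \<psi> \<le> Y_state r"
      using Suc.IH C_below_r_invariant[OF \<psi>_below, of n] unfolding C_below_iff by (blast intro: order_trans)
    then have "L ((L ^^ n) \<psi>) \<le> Q ((L ^^ n) \<psi>)" using Ln by (intro le) (simp add: C_below_iff)
    also have "\<dots> \<le> Q ((Q ^^ n) \<psi>)" by (intro Q_mono Ln Q_funpow_C_plus \<psi> Suc.IH)
    finally show ?case by simp
  qed simp
  have "\<psi> \<in> C_plus - {C_zero}" using \<psi> \<open>\<psi> \<noteq> C_zero\<close> by simp
  then obtain \<kappa> where \<kappa>: "0 < \<kappa>" and persistent: "\<And>Y. \<exists>m y. Y \<le> y \<and> tent \<rho> \<kappa> y \<le> (L ^^ m) \<psi>"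
    by (rule L.persistent_of_subhomogeneous[OF subhom SP dp]) (rule that)
  have tent_le_tent: "tent r (\<kappa> * (d / (R + 1))) y \<le> tent \<rho> \<kappa> y" for y
    unfolding state_le_iff
  proof (intro allI)
    fix \<theta> x i
    have "r \<theta> $ i \<le> R + 1" using R[of \<theta>] component_le_norm_cart[of "r \<theta>" i] by linarith
    then have "d / (R + 1) * r \<theta> $ i \<le> d / (R + 1) * (R + 1)"
      using d(1) \<open>0 \<le> R\<close> by (intro mult_left_mono) auto
    then have "d / (R + 1) * r \<theta> $ i \<le> \<rho> \<theta> $ i" using d(2)[of \<theta> i] \<open>0 \<le> R\<close> by simp
    then have "\<kappa> * max 0 (1 - \<bar>x - y\<bar>) * (d / (R + 1) * r \<theta> $ i) \<le> \<kappa> * max 0 (1 - \<bar>x - y\<bar>) * \<rho> \<theta> $ i"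
      using \<kappa> by (intro mult_left_mono) auto
    then show "tent r (\<kappa> * (d / (R + 1))) y \<theta> x $ i \<le> tent \<rho> \<kappa> y \<theta> x $ i"
      unfolding tent_nth by (simp only: mult_ac)
  qed
  show thesis
  proof (rule that)
    show "0 < \<kappa> * (d / (R + 1))" using \<kappa> d(1) \<open>0 \<le> R\<close> by simp
    fix Y
    obtain m y where "Y \<le> y" and m: "tent \<rho> \<kappa> y \<le> (L ^^ m) \<psi>" using persistent by blast
    have "tent r (\<kappa> * (d / (R + 1))) y \<le> tent \<rho> \<kappa> y" by (rule tent_le_tent)
    also note m
    also note L_le
    also have "(Q ^^ m) \<psi> \<le> (Q ^^ m) \<phi>" by (intro Q_funpow_mono \<psi> \<phi>' \<psi>_le)
    finally show "\<exists>m y. Y \<le> y \<and> tent r (\<kappa> * (d / (R + 1))) y \<le> (Q ^^ m) \<phi>" using \<open>Y \<le> y\<close> by blast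
  qed
qed

section \<open>Convergence to the equilibrium\<close>

lemma max0_Y_norm_bounds:
  assumes e: "0 \<le> e" and small: "\<And>\<theta> x. x \<in> S \<Longrightarrow> norm (\<psi> \<theta> x - r \<theta>) \<le> e"
  shows "0 \<le> max0 S (\<lambda>x. Y_norm (\<lambda>\<theta>. \<psi> \<theta> x - r \<theta>))"
    and "max0 S (\<lambda>x. Y_norm (\<lambda>\<theta>. \<psi> \<theta> x - r \<theta>)) \<le> e"
proof -
  let ?f = "\<lambda>x. Y_norm (\<lambda>\<theta>. \<psi> \<theta> x - r \<theta>)"
  have f_le: "?f x \<le> e" if "x \<in> S" for x
    unfolding Y_norm_def by (rule cSUP_least) (use small[OF that] in auto)
  have f_ge: "0 \<le> ?f x" if "x \<in> S" for x
  proof -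
    have "norm (\<psi> undefined x - r undefined) \<le> ?f x"
      unfolding Y_norm_def by (rule cSUP_upper) (use small[OF that] in \<open>auto intro!: bdd_aboveI2\<close>)
    then show ?thesis using norm_ge_zero order_trans by blast
  qed
  show "max0 S ?f \<le> e"
    using e f_le by (auto simp: max0_def intro!: cSUP_least)
  show "0 \<le> max0 S ?f"
  proof (cases "S = {}")
    case False
    then obtain x where x: "x \<in> S" by blast
    have "?f x \<le> (SUP x\<in>S. ?f x)" by (rule cSUP_upper[OF x]) (use f_le in \<open>auto intro!: bdd_aboveI2\<close>)
    then show ?thesis using f_ge[OF x] False by (simp add: max0_def)
  qed (simp add: max0_def)
qed

text \<open>
  The upper estimate is \<open>Q\<^sup>n \<phi> \<le> Q\<^sub>+\<^sup>n \<phi>\<close> together with \<open>(UC)\<close>, the lower one comes from tents. The norm of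
  a vector is at most the sum of the absolute values of its components, which explains the factor \<open>CARD('n)\<close> in \<open>\<eta>\<close>.
\<close>

lemma convergence_of_persistent:
  assumes \<phi>: "\<phi> \<in> C_plus - {C_zero}" and \<kappa>: "0 < \<kappa>"
    and persistent: "\<And>Y. \<exists>m y. Y \<le> y \<and> tent r \<kappa> y \<le> (Q ^^ m) \<phi>"
    and \<epsilon>: "0 < \<epsilon>" "\<epsilon> < (cp + cm) / 2"
  shows "(\<lambda>n. max0 {x. real n * max \<epsilon> (- cm + \<epsilon>) \<le> x \<and> x \<le> real n * (cp - \<epsilon>)}
    (\<lambda>x. Y_norm (\<lambda>\<theta>. (Q ^^ n) \<phi> \<theta> x - r \<theta>))) \<longlonglongrightarrow> 0"
proof (rule tendstoI)
  fix e :: real assume e: "0 < e"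
  let ?S = "\<lambda>n. {x. real n * max \<epsilon> (- cm + \<epsilon>) \<le> x \<and> x \<le> real n * (cp - \<epsilon>)}"
  have \<phi>': "\<phi> \<in> C_plus" using \<phi> by simp
  define \<eta> where "\<eta> = e / (2 * real CARD('n))"
  have \<eta>: "0 < \<eta>" "real CARD('n) * \<eta> = e / 2" using e by (simp_all add: \<eta>_def)
  obtain R where R: "\<And>\<theta>. norm (r \<theta>) \<le> R"
    by (rule Int_Y_plus_upper_bound[OF M_compact r]) (rule that)
  have "0 \<le> R" using R[of undefined] norm_ge_zero order_trans by blast
  define s where "s = max (1/2) (1 - \<eta> / (R + 1))"
  have s: "0 < s" "s < 1" using \<eta>(1) \<open>0 \<le> R\<close> by (auto simp: s_def)
  have s_le: "r \<theta> $ i - \<eta> \<le> s * r \<theta> $ i" for \<theta> i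
  proof -
    have "r \<theta> $ i \<le> R + 1" using R[of \<theta>] component_le_norm_cart[of "r \<theta>" i] by linarith
    then have "(1 - s) * r \<theta> $ i \<le> \<eta> / (R + 1) * (R + 1)"
      using \<eta>(1) \<open>0 \<le> R\<close> Int_Y_plus_nth_pos[OF r, of \<theta> i] by (intro mult_mono) (auto simp: s_def)
    moreover have "\<eta> / (R + 1) * (R + 1) = \<eta>" using \<open>0 \<le> R\<close> by simp
    ultimately show ?thesis by (simp add: algebra_simps)
  qed
  show "\<forall>\<^sub>F n in sequentially.
      dist (max0 (?S n) (\<lambda>x. Y_norm (\<lambda>\<theta>. (Q ^^ n) \<phi> \<theta> x - r \<theta>))) 0 < e"
    using spreading_of_persistent[OF \<phi>' \<kappa> persistent s \<epsilon>] UC_uniform[OF \<phi> \<epsilon> \<eta>(1)]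
  proof eventually_elim
    fix n
    assume low: "\<forall>\<theta> x i. real n * max \<epsilon> (- cm + \<epsilon>) \<le> x \<and> x \<le> real n * (cp - \<epsilon>) \<longrightarrow>
        s * r \<theta> $ i \<le> (Q ^^ n) \<phi> \<theta> x $ i"
      and up: "\<forall>\<theta>. \<forall>x\<in>{real n * (- cm + \<epsilon>)..real n * (cp - \<epsilon>)}.
        norm ((lim_plus Q ^^ n) \<phi> \<theta> x - r \<theta>) < \<eta>"
    have "norm ((Q ^^ n) \<phi> \<theta> x - r \<theta>) \<le> e / 2" if x: "x \<in> ?S n" for \<theta> x
    proof -
      have "real n * (- cm + \<epsilon>) \<le> real n * max \<epsilon> (- cm + \<epsilon>)" by (intro mult_left_mono) auto
      then have x': "x \<in> {real n * (- cm + \<epsilon>)..real n * (cp - \<epsilon>)}" using x by simp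
      have "\<bar>((Q ^^ n) \<phi> \<theta> x - r \<theta>) $ i\<bar> \<le> \<eta>" for i
      proof -
        have "norm ((lim_plus Q ^^ n) \<phi> \<theta> x - r \<theta>) < \<eta>" using up x' by blast
        then have "(lim_plus Q ^^ n) \<phi> \<theta> x $ i - r \<theta> $ i \<le> \<eta>"
          using component_le_norm_cart[of "(lim_plus Q ^^ n) \<phi> \<theta> x - r \<theta>" i] by simp
        moreover have "(Q ^^ n) \<phi> \<theta> x $ i \<le> (lim_plus Q ^^ n) \<phi> \<theta> x $ i"
          using Q_funpow_le_lim_plus[OF \<phi>'] unfolding state_le_iff by blast
        moreover have "s * r \<theta> $ i \<le> (Q ^^ n) \<phi> \<theta> x $ i" using low x by blast
        ultimately show ?thesis using s_le[of \<theta> i] by simp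
      qed
      then have "(\<Sum>i\<in>UNIV. \<bar>((Q ^^ n) \<phi> \<theta> x - r \<theta>) $ i\<bar>) \<le> (\<Sum>i\<in>(UNIV :: 'n set). \<eta>)"
        by (intro sum_mono)
      then show ?thesis
        using norm_le_l1_cart[of "(Q ^^ n) \<phi> \<theta> x - r \<theta>"] \<eta>(2) by simp
    qed
    from max0_Y_norm_bounds[of "e / 2" "?S n" "(Q ^^ n) \<phi>", OF _ this] e show "dist (max0 (?S n) (\<lambda>x. Y_norm (\<lambda>\<theta>. (Q ^^ n) \<phi> \<theta> x - r \<theta>))) 0 < e"
      by simp
  qed
qed

end

theorem theorem3p1:
  fixes Q :: "('m::topological_space, 'n::finite) state \<Rightarrow> ('m, 'n) state"
    and rstar :: "'m \<Rightarrow> real ^ 'n"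
    and cm cp \<epsilon> :: real
    and \<phi> :: "('m, 'n) state"
  assumes "compact (UNIV :: 'm set)"
    and "Q \<in> C_plus \<rightarrow> C_plus"
    and "A1 Q" and "A2 Q" and "A3 Q" and "A4 Q rstar"
    and "UC (lim_plus Q) cm cp rstar"
    and "(subhomogeneous_on (C_below (Y_state rstar)) Q \<and> SP Q) \<or>
      (\<exists>cml cpl rl Ql. ASH_UC_SP Q rstar cml cpl rl Ql \<and> cml \<longlonglongrightarrow> cm \<and> cpl \<longlonglongrightarrow> cp)"
    and "0 < cp"
    and "\<epsilon> \<in> {0<..<min cp ((cp + cm) / 2)}"
    and "\<phi> \<in> C_plus - {C_zero}"
  shows "(\<lambda>n. max0 {x. real n * max \<epsilon> (- cm + \<epsilon>) \<le> x \<and> x \<le> real n * (cp - \<epsilon>)}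
           (\<lambda>x. Y_norm (\<lambda>\<theta>. (Q ^^ n) \<phi> \<theta> x - rstar \<theta>))) \<longlonglongrightarrow> 0"
proof -
  have conv: "limitin C_top (\<lambda>y. shift_conj Q y \<psi>) (lim_plus Q \<psi>) at_top" if "\<psi> \<in> C_plus" for \<psi>
  proof -
    have "limitin C_top (\<lambda>y. shift_conj (Q ^^ 1) y \<psi>) ((lim_plus Q ^^ 1) \<psi>) at_top"
      using assms(5) that unfolding A3_def by blast
    then show ?thesis by simp
  qed
  interpret spreading_map Q rstar cm cp
    by unfold_locales (use assms conv in \<open>auto simp: A4_def\<close>)
  obtain \<kappa> where \<kappa>: "0 < \<kappa>" and "\<And>Y. \<exists>m y. Y \<le> y \<and> tent rstar \<kappa> y \<le> (Q ^^ m) \<phi>"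
    using assms(8)
  proof (elim disjE exE conjE)
    assume "subhomogeneous_on (C_below (Y_state rstar)) Q" "SP Q"
    then show thesis
      by (rule persistent_of_subhomogeneous[OF _ _ assms(9,11)]) (rule that)
  next
    fix cml cpl rl Ql
    assume ASH: "ASH_UC_SP Q rstar cml cpl rl Ql" and "cpl \<longlonglongrightarrow> cp"
    \<comment> \<open>A single approximating map with positive rightward speed gives persistence; the
      equilibrium and the speeds of the conclusion then come from \<open>(UC)\<close> for \<open>Q\<^sub>+\<close>.\<close>
    then have "\<forall>\<^sub>F l in sequentially. 0 < cpl l" using assms(9) by (intro order_tendstoD(1))
    then have "\<forall>\<^sub>F l in sequentially. 0 < cpl l \<and> 1 \<le> l"
      by (intro eventually_conj eventually_ge_at_top)
    then obtain l where l: "0 < cpl l" "1 \<le> l"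
      using eventually_happens'[OF sequentially_bot] by blast
    note ASH_l = ASH[unfolded ASH_UC_SP_def, rule_format, OF l(2)]
    have "spreading_map (Ql l) (rl l) (cml l) (cpl l)"
      by unfold_locales (use ASH_l assms(1) in auto)
    then show thesis
      by (rule persistent_of_minorant[of _ _ _ _ \<phi>]) (use ASH_l l(1) assms(11) that in auto)
  qed
  then show ?thesis
    by (rule convergence_of_persistent[OF assms(11)]) (use assms(10) in auto)
qed

end
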